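(* For $n\ge1$, $d\ge1$, let $h_{n,d}$ denote the number of unitary equivalence classes of cyclic harmonic frames $\Phi_J$, where $J$ ranges over the $d$-element subsets of $\mathbb{Z}_n$ that generate $\mathbb{Z}_n$. If $d=1$ then $h_{n,1}=1$ for all $n$. If $d\ge2$ is fixed, then for every $\epsilon>0$, $$h_{n,d}=\frac{n^d}{d!\,\varphi(n)}\prod_{p\mid n}\bigl(1-p^{-d}\bigr)\bigl(1+O_\epsilon(n^{-1+\epsilon})\bigr),\qquad n\to\infty,$$ where $\varphi$ is Euler's totient function, the product is over the distinct prime divisors $p$ of $n$, and the implied constant depends only on $\epsilon$ and $d$.
   Context: Let $\omega=e^{2\pi i/n}$ and let $\mathbb{Z}_n$ be the additive cyclic group of order $n$. For a $d$-element subset $J\subset\mathbb{Z}_n$, the cyclic harmonic frame $\Phi_J$ is the sequence $(v_k)_{k\in\mathbb{Z}_n}$ of vectors $v_k=(\omega^{jk})_{j\in J}\in\mathbb{C}^J\cong\mathbb{C}^d$; its $n$ vectors are distinct if and only if $J$ generates $\mathbb{Z}_n$. Two finite sequences $(v_k)_{k\in I}$ and $(w_k)_{k\in I'}$ of vectors in $\mathbb{C}^d$ are unitarily equivalent if there is a unitary map $U$ on $\mathbb{C}^d$ and a bijection $\sigma:I\to I'$ with $v_k=Uw_{\sigma(k)}$ for all $k\in I$. *)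

theory Defs
  imports "HOL-Analysis.Analysis" "HOL-Number_Theory.Number_Theory"
begin

definition root_of_unity :: "nat \<Rightarrow> complex" where
  "root_of_unity n = exp (2 * of_real pi * \<i> / of_nat n)"

definition generates_Zn :: "nat \<Rightarrow> nat set \<Rightarrow> bool" where
  "generates_Zn n J \<longleftrightarrow> (\<forall>x<n. \<exists>c :: nat \<Rightarrow> int. [(\<Sum>j\<in>J. c j * int j) = int x] (mod int n))"

text \<open>The cyclic harmonic frame Phi_J: the vector v_k (k in Z_n) in C^J, identified with C^d
  (d = card J) via the increasing enumeration of J; coordinate i < d is omega^(j_i k).\<close>
definition harmonic_frame :: "nat \<Rightarrow> nat set \<Rightarrow> nat \<Rightarrow> nat \<Rightarrow> complex" where
  "harmonic_frame n J k i = root_of_unity n ^ (sorted_list_of_set J ! i * k)"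

definition unitary_mat :: "nat \<Rightarrow> (nat \<Rightarrow> nat \<Rightarrow> complex) \<Rightarrow> bool" where
  "unitary_mat d U \<longleftrightarrow> (\<forall>i<d. \<forall>j<d. (\<Sum>k<d. cnj (U k i) * U k j) = (if i = j then 1 else 0))"

definition mat_apply :: "nat \<Rightarrow> (nat \<Rightarrow> nat \<Rightarrow> complex) \<Rightarrow> (nat \<Rightarrow> complex) \<Rightarrow> nat \<Rightarrow> complex" where
  "mat_apply d U w i = (\<Sum>j<d. U i j * w j)"

definition unitarily_equivalent ::
  "nat \<Rightarrow> 'a set \<Rightarrow> ('a \<Rightarrow> nat \<Rightarrow> complex) \<Rightarrow> 'b set \<Rightarrow> ('b \<Rightarrow> nat \<Rightarrow> complex) \<Rightarrow> bool" where
  "unitarily_equivalent d I v I' w \<longleftrightarrow>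
     (\<exists>U \<sigma>. unitary_mat d U \<and> bij_betw \<sigma> I I' \<and>
        (\<forall>k\<in>I. \<forall>i<d. v k i = mat_apply d U (w (\<sigma> k)) i))"

definition generating_subsets :: "nat \<Rightarrow> nat \<Rightarrow> nat set set" where
  "generating_subsets n d = {J. J \<subseteq> {..<n} \<and> card J = d \<and> generates_Zn n J}"

definition frame_equiv_rel :: "nat \<Rightarrow> nat \<Rightarrow> (nat set \<times> nat set) set" where
  "frame_equiv_rel n d = {(J, J'). J \<in> generating_subsets n d \<and> J' \<in> generating_subsets n d \<and>
      unitarily_equivalent d {..<n} (harmonic_frame n J) {..<n} (harmonic_frame n J')}"

definition h_count :: "nat \<Rightarrow> nat \<Rightarrow> nat" where
  "h_count n d = card (generating_subsets n d // frame_equiv_rel n d)"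

definition main_term :: "nat \<Rightarrow> nat \<Rightarrow> real" where
  "main_term n d = real n ^ d / (fact d * real (totient n)) *
      (\<Prod>p\<in>prime_factors n. 1 - real p powr (- real d))"

end

theory Submission
  imports Defs "HOL-Combinatorics.Multiset_Permutations"
begin

text \<open>
  Multiplication by a unit \<open>a\<close> of \<open>\<int>\<^sub>n\<close> carries \<open>\<Phi>\<^sub>J\<close> to a frame equivalent to it, so the count is at most the
  number of unit orbits on generating \<open>d\<close>-sets. Conversely, an equivalence between the frames of \<open>J\<close> and \<open>J'\<close>
  expresses each character in \<open>J'\<close>, composed with the bijection, as a unimodular combination of
  the characters in \<open>J\<close>. If \<open>J\<close> is a Sidon set modulo \<open>n\<close>, this forces a single character, the
  bijection is affine, and \<open>J = aJ'\<close>. Call \<open>J\<close> good if it is Sidon with trivial stabiliser. Good sets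
  have orbits of size \<open>\<phi>(n)\<close>, and every orbit has size at least \<open>\<phi>(n) / d ^ d\<close>. In a bad set some
  element is determined by the others up to a number of choices bounded in terms of \<open>d\<close> and the
  number of solutions of \<open>a\<^sup>2 = 1\<close> in \<open>\<int>\<^sub>n\<close>, which is at most twice the number of divisors of \<open>n\<close>; hence
  there are \<open>O(n powr (d - 1 + \<epsilon>))\<close> bad sets. The generating \<open>d\<close>-tuples are counted by
  Jordan's totient, and the non-injective ones among them are \<open>O(n ^ (d - 1))\<close>.
\<close>

subsection \<open>Multiplication by units\<close>

definition unit_image :: "nat \<Rightarrow> nat \<Rightarrow> nat set \<Rightarrow> nat set" where
  "unit_image n a J = (\<lambda>x. a * x mod n) ` J"

text \<open>Once \<open>a\<close> is matched, the congruence fixes \<open>e\<close> as well when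
  \<open>J \<subseteq> {..<n}\<close>. With \<open>e = a\<close> and \<open>b = c\<close> the
  condition also keeps distinct elements from having congruent doubles.\<close>

definition sidon_mod :: "nat \<Rightarrow> nat set \<Rightarrow> bool" where
  "sidon_mod n J \<longleftrightarrow>
     (\<forall>a\<in>J. \<forall>b\<in>J. \<forall>c\<in>J. \<forall>e\<in>J. [a + e = b + c] (mod n) \<longrightarrow> a = b \<or> a = c)"

lemma inj_on_mult_mod:
  fixes n a :: nat
  assumes "coprime a n" "J \<subseteq> {..<n}"
  shows "inj_on (\<lambda>x. a * x mod n) J"
proof (rule inj_onI)
  fix x y assume "x \<in> J" "y \<in> J" "a * x mod n = a * y mod n"
  then have "[a * x = a * y] (mod n)" by (simp add: cong_def)
  then have "[x = y] (mod n)" using assms(1) by (simp add: cong_mult_lcancel_nat)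
  moreover have "x < n" "y < n" using assms(2) \<open>x \<in> J\<close> \<open>y \<in> J\<close> by auto
  ultimately show "x = y" by (rule cong_less_modulus_unique_nat)
qed

lemma unit_image_subset: "n > 0 \<Longrightarrow> unit_image n a J \<subseteq> {..<n}"
  by (auto simp: unit_image_def)

lemma unit_image_comp: "unit_image n a (unit_image n b J) = unit_image n (a * b) J"
  by (simp add: unit_image_def image_image mod_mult_right_eq mult.assoc)

lemma unit_image_cong:
  "[a = b] (mod n) \<Longrightarrow> unit_image n a J = unit_image n b J"
  unfolding unit_image_def by (rule image_cong) (auto simp: cong_def intro: mod_mult_cong)

lemma unit_image_one: "J \<subseteq> {..<n} \<Longrightarrow> unit_image n 1 J = J"
  by (auto simp: unit_image_def subset_iff image_iff)

lemma card_unit_image: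
  "coprime a n \<Longrightarrow> J \<subseteq> {..<n} \<Longrightarrow> card (unit_image n a J) = card J"
  unfolding unit_image_def by (intro card_image inj_on_mult_mod)

lemma coprime_inverse_mod:
  fixes a n :: nat
  assumes "coprime a n"
  obtains b where "coprime b n" "[b * a = 1] (mod n)"
proof -
  from assms obtain b where b: "[a * b = Suc 0] (mod n)"
    using cong_solve_coprime_nat by meson
  then have "[b * a = Suc 0] (mod n)" by (simp add: mult.commute)
  moreover from this have "coprime b n"
    by (auto simp: coprime_iff_invertible_nat)
  ultimately show thesis using that by simp
qed

lemma unit_image_inverse:
  assumes "coprime a n" "J \<subseteq> {..<n}"
  obtains b where "coprime b n" "unit_image n b (unit_image n a J) = J"
proof -
  obtain b where b: "coprime b n" "[b * a = 1] (mod n)"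
    using coprime_inverse_mod assms by blast
  have "unit_image n b (unit_image n a J) = unit_image n 1 J"
    unfolding unit_image_comp by (rule unit_image_cong[OF b(2)])
  then show thesis
    by (intro that[OF b(1)]) (simp only: unit_image_one[OF assms(2)])
qed

section \<open>Generating sets and their behaviour under units\<close>

lemma bezout_finite_set:
  fixes J :: "nat set"
  assumes "finite J"
  shows "\<exists>c :: nat \<Rightarrow> int. (\<Sum>j\<in>J. c j * int j) = int (Gcd J)"
  using assms
proof (induction J)
  case empty
  then show ?case by simp
next
  case (insert x J)
  then obtain c :: "nat \<Rightarrow> int" where c: "(\<Sum>j\<in>J. c j * int j) = int (Gcd J)" by blast
  obtain u v where uv: "u * int x + v * int (Gcd J) = gcd (int x) (int (Gcd J))"
    using bezout_int by blast
  have eq: "(\<Sum>j\<in>J. (if j = x then u else v * c j) * int j) = v * (\<Sum>j\<in>J. c j * int j)"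
    using insert.hyps unfolding sum_distrib_left by (intro sum.cong) auto
  have "(\<Sum>j\<in>insert x J. (if j = x then u else v * c j) * int j) = int (Gcd (insert x J))"
    unfolding sum.insert[OF insert.hyps] eq using uv c by simp
  then show ?case by (rule exI[where x = "\<lambda>j. if j = x then u else v * c j"])
qed

text \<open>A common divisor of \<open>n\<close> and all elements divides the combination
  representing 1; conversely, Bezout coefficients can be rescaled by an inverse of
  \<open>Gcd J\<close>. In this form generation can be sieved prime by prime.\<close>

lemma generates_Zn_iff_Gcd:
  assumes "finite J" "n > 0"
  shows "generates_Zn n J \<longleftrightarrow> coprime (Gcd J) n"
proof
  assume gen: "generates_Zn n J"
  show "coprime (Gcd J) n"
  proof (rule coprimeI)
    fix g assume g: "g dvd Gcd J" "g dvd n"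
    \<comment> \<open>\<open>1 mod n\<close> rather than 1, because for \<open>n = 1\<close> the
      only residue available is 0.\<close>
    obtain c :: "nat \<Rightarrow> int" where c: "[(\<Sum>j\<in>J. c j * int j) = int (1 mod n)] (mod int n)"
      using gen assms unfolding generates_Zn_def by (meson mod_less_divisor)
    then have "[(\<Sum>j\<in>J. c j * int j) = 1] (mod int n)"
      by (simp only: of_nat_mod of_nat_1 cong_mod_right)
    then have "[(\<Sum>j\<in>J. c j * int j) = 1] (mod int g)"
      by (rule cong_dvd_modulus) (simp add: g)
    moreover have "int g dvd (\<Sum>j\<in>J. c j * int j)"
      using g(1) by (intro dvd_sum dvd_mult) (auto intro: dvd_trans)
    ultimately have "int g dvd 1" by (simp only: cong_dvd_iff)
    then show "is_unit g" by simp
  qed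
next
  assume cop: "coprime (Gcd J) n"
  obtain c :: "nat \<Rightarrow> int" where c: "(\<Sum>j\<in>J. c j * int j) = int (Gcd J)"
    using bezout_finite_set[OF assms(1)] by blast
  obtain u where u: "[u * Gcd J = 1] (mod n)"
    using coprime_inverse_mod[OF cop] by blast
  then have "[int (u * Gcd J) = int 1] (mod int n)"
    by (simp only: cong_int_iff)
  then have u': "[int u * int (Gcd J) = 1] (mod int n)"
    by (simp only: of_nat_mult of_nat_1)
  show "generates_Zn n J"
    unfolding generates_Zn_def
  proof (intro allI impI)
    fix x assume "x < n"
    have "(\<Sum>j\<in>J. (int x * int u * c j) * int j) = int x * (int u * int (Gcd J))"
      by (simp only: c[symmetric] sum_distrib_left mult.assoc)
    moreover have "[\<dots> = int x * 1] (mod int n)" by (intro cong_scalar_left u')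
    ultimately have "[(\<Sum>j\<in>J. (int x * int u * c j) * int j) = int x] (mod int n)" by simp
    then show "\<exists>c :: nat \<Rightarrow> int. [(\<Sum>j\<in>J. c j * int j) = int x] (mod int n)"
      by (rule exI[where x = "\<lambda>j. int x * int u * c j"])
  qed
qed

text \<open>Write 1 as a combination of \<open>J\<close> and sum the congruences with its
  coefficients. This cancels a generating set as a whole, although its single elements may be zero
  divisors.\<close>

lemma generates_Zn_cancel:
  assumes "generates_Zn n J" "n > 0" "\<And>j. j \<in> J \<Longrightarrow> [a * j = b * j] (mod n)"
  shows "[a = b] (mod n)"
proof -
  obtain c :: "nat \<Rightarrow> int" where "[(\<Sum>j\<in>J. c j * int j) = int (1 mod n)] (mod int n)"
    using assms unfolding generates_Zn_def by (meson mod_less_divisor)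
  then have c: "[(\<Sum>j\<in>J. c j * int j) = 1] (mod int n)"
    by (simp only: of_nat_mod of_nat_1 cong_mod_right)
  have "[int a * 1 = int a * (\<Sum>j\<in>J. c j * int j)] (mod int n)"
    by (intro cong_scalar_left cong_sym[OF c])
  also have "int a * (\<Sum>j\<in>J. c j * int j) = (\<Sum>j\<in>J. c j * int (a * j))"
    by (simp add: sum_distrib_left mult_ac)
  also have "[\<dots> = (\<Sum>j\<in>J. c j * int (b * j))] (mod int n)"
    using assms(3) by (intro cong_sum cong_scalar_left) (simp add: cong_int_iff del: of_nat_mult)
  also have "(\<Sum>j\<in>J. c j * int (b * j)) = int b * (\<Sum>j\<in>J. c j * int j)"
    by (simp add: sum_distrib_left mult_ac)
  also have "[\<dots> = int b * 1] (mod int n)"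
    by (intro cong_scalar_left c)
  finally show ?thesis by (simp add: cong_int_iff)
qed

lemma generates_Zn_unit_image:
  assumes "generates_Zn n J" "coprime a n" "finite J" "n > 0"
  shows "generates_Zn n (unit_image n a J)"
proof -
  have "coprime (Gcd (unit_image n a J)) n"
  proof (rule ccontr)
    assume "\<not> coprime (Gcd (unit_image n a J)) n"
    then have "gcd (Gcd (unit_image n a J)) n \<noteq> 1"
      using coprime_iff_gcd_eq_1 by metis
    then obtain p where "prime p" "p dvd gcd (Gcd (unit_image n a J)) n"
      using prime_factor_nat by blast
    then have p: "prime p" "p dvd Gcd (unit_image n a J)" "p dvd n"
      by auto
    have "p dvd j" if "j \<in> J" for j
    proof -
      have "a * j mod n \<in> unit_image n a J" using that by (simp add: unit_image_def)
      then have "p dvd a * j mod n" by (rule dvd_trans[OF p(2) Gcd_dvd_nat])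
      \<comment> \<open>\<open>p\<close> divides \<open>n\<close>, so reduction modulo
        \<open>n\<close> does not affect divisibility by \<open>p\<close>.\<close>
      then have "p dvd a * j" using p(3) by (simp add: dvd_mod_iff)
      moreover have "\<not> p dvd a" using p assms(2) by (meson coprime_common_divisor not_prime_unit)
      ultimately show ?thesis using p(1) by (simp add: prime_dvd_mult_iff)
    qed
    then have "p dvd Gcd J" by (simp add: Gcd_greatest)
    then show False using p assms generates_Zn_iff_Gcd[OF assms(3,4)]
      by (meson coprime_common_divisor not_prime_unit)
  qed
  then show ?thesis using assms generates_Zn_iff_Gcd by (simp add: unit_image_def)
qed

lemma generating_subsetsD:
  assumes "J \<in> generating_subsets n d"
  shows "J \<subseteq> {..<n}" "finite J" "card J = d" "generates_Zn n J"
  using assms finite_subset unfolding generating_subsets_def by blast+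

lemma finite_generating_subsets: "finite (generating_subsets n d)"
  by (rule finite_subset[of _ "Pow {..<n}"]) (auto simp: generating_subsets_def)

lemma unit_image_generating:
  assumes "J \<in> generating_subsets n d" "coprime a n" "n > 0"
  shows "unit_image n a J \<in> generating_subsets n d"
  using generating_subsetsD[OF assms(1)] assms(2,3)
  by (simp add: generating_subsets_def card_unit_image generates_Zn_unit_image unit_image_subset)

lemma sidon_mod_unit_image:
  assumes "sidon_mod n J" "coprime a n"
  shows "sidon_mod n (unit_image n a J)"
  unfolding sidon_mod_def
proof (intro ballI impI)
  fix w x y z assume "w \<in> unit_image n a J" "x \<in> unit_image n a J" "y \<in> unit_image n a J"
    "z \<in> unit_image n a J" and eq: "[w + z = x + y] (mod n)"
  then obtain w' x' y' z' where
    J: "w' \<in> J" "x' \<in> J" "y' \<in> J" "z' \<in> J"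
    and [simp]: "w = a * w' mod n" "x = a * x' mod n" "y = a * y' mod n" "z = a * z' mod n"
    unfolding unit_image_def by blast
  have "[a * (w' + z') = a * (x' + y')] (mod n)"
    using eq by (simp add: cong_def mod_add_eq distrib_left)
  then have "[w' + z' = x' + y'] (mod n)"
    using assms(2) by (simp add: cong_mult_lcancel_nat)
  then have "w' = x' \<or> w' = y'" using assms(1) J unfolding sidon_mod_def by blast
  then show "w = x \<or> w = y" by auto
qed

text \<open>\<open>totatives n\<close> lives in \<open>{1..n}\<close>, not in \<open>{..<n}\<close>.
  If one of the numbers is \<open>n\<close>, both are divisible by \<open>n\<close> and hence equal
  \<open>n\<close>; otherwise both are reduced residues.\<close>

lemma totatives_cong_eq:
  assumes "[a = b] (mod n)" "a \<in> totatives n" "b \<in> totatives n"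
  shows "a = b"
proof (cases "a = n \<or> b = n")
  case True
  then have "n dvd a" "n dvd b" using assms(1) cong_dvd_iff[of a b n] by auto
  then show ?thesis using assms by (auto simp: in_totatives_iff dest!: dvd_imp_le)
next
  case False
  then show ?thesis using assms cong_less_modulus_unique_nat[of a b n]
    by (simp add: in_totatives_iff)
qed

text \<open>A multiplier is determined by its restriction to a generating set.\<close>
lemma card_unit_fibre_le:
  assumes "J \<in> generating_subsets n d" "n > 0"
  shows "card {a \<in> totatives n. unit_image n a J = K} \<le> d ^ d"
proof (cases "{a \<in> totatives n. unit_image n a J = K} = {}")
  case False
  note J = generating_subsetsD[OF assms(1)]
  from False have K: "finite K" "card K = d"
    using J card_unit_image by (auto simp: in_totatives_iff finite_subset[OF unit_image_subset[OF assms(2)]])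
  let ?F = "\<lambda>a. restrict (\<lambda>x. a * x mod n) J"
  have inj: "inj_on ?F {a \<in> totatives n. unit_image n a J = K}"
  proof (rule inj_onI)
    fix a b assume a: "a \<in> {a \<in> totatives n. unit_image n a J = K}"
      and b: "b \<in> {a \<in> totatives n. unit_image n a J = K}" and eq: "?F a = ?F b"
    have "[a * j = b * j] (mod n)" if "j \<in> J" for j
      using fun_cong[OF eq, of j] that by (simp add: cong_def)
    then have "[a = b] (mod n)" by (rule generates_Zn_cancel[OF J(4) assms(2)])
    then show "a = b" using a b totatives_cong_eq by blast
  qed
  have sub: "?F ` {a \<in> totatives n. unit_image n a J = K} \<subseteq> J \<rightarrow>\<^sub>E K"
    by (auto simp: unit_image_def)
  have "card {a \<in> totatives n. unit_image n a J = K} \<le> card (J \<rightarrow>\<^sub>E K)"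
    using J K sub by (intro card_inj_on_le[OF inj sub]) (auto intro: finite_PiE)
  also have "\<dots> = d ^ d" using J K by (simp add: card_funcsetE)
  finally show ?thesis .
qed (simp only: card.empty le0)

subsection \<open>Unitary equivalence of harmonic frames\<close>

lemma root_of_unity_power_eq_iff:
  assumes "n > 0"
  shows "root_of_unity n ^ a = root_of_unity n ^ b \<longleftrightarrow> [a = b] (mod n)"
proof -
  have "root_of_unity n ^ k = exp (2 * of_real pi * \<i> * of_nat k / of_nat n)" for k
    unfolding root_of_unity_def exp_of_nat_mult[symmetric] by (simp add: mult_ac)
  then show ?thesis using assms by (simp add: complex_root_unity_eq cong_def)
qed

lemma norm_root_of_unity_power [simp]: "norm (root_of_unity n ^ a) = 1"
proof -
  have "norm (root_of_unity n) = 1" unfolding root_of_unity_def by (simp add: norm_exp_eq_Re)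
  then show ?thesis by (simp add: norm_power)
qed

lemma root_of_unity_power_cnj [simp]: "root_of_unity n ^ a * cnj (root_of_unity n ^ a) = 1"
  by (simp only: complex_norm_square[symmetric] norm_root_of_unity_power) simp

text \<open>The summand is the \<open>k\<close>-th power of a single \<open>n\<close>-th root of
  unity \<open>?z\<close>, and the full geometric sum vanishes unless \<open>?z = 1\<close>.
  Conjugation replaces negative exponents, since \<open>a\<close> and \<open>b\<close> are natural
  numbers.\<close>

lemma sum_character_orthogonal:
  assumes "n > 0"
  shows "(\<Sum>k<n. root_of_unity n ^ (a * k) * cnj (root_of_unity n ^ (b * k))) =
           (if [a = b] (mod n) then of_nat n else 0)"
proof -
  let ?z = "root_of_unity n ^ a * cnj (root_of_unity n ^ b)"
  have char_power: "root_of_unity n ^ (a * k) * cnj (root_of_unity n ^ (b * k)) = ?z ^ k" for k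
    by (simp add: power_mult power_mult_distrib)
  have "?z = 1 \<longleftrightarrow> root_of_unity n ^ a = root_of_unity n ^ b"
  proof
    assume "?z = 1"
    then have "?z * root_of_unity n ^ b = root_of_unity n ^ b" by simp
    moreover have "?z * root_of_unity n ^ b
        = root_of_unity n ^ a * (root_of_unity n ^ b * cnj (root_of_unity n ^ b))"
      by (simp only: mult_ac)
    ultimately show "root_of_unity n ^ a = root_of_unity n ^ b"
      by (simp only: root_of_unity_power_cnj mult_1_right)
  next
    assume "root_of_unity n ^ a = root_of_unity n ^ b"
    then show "?z = 1" by (simp only: root_of_unity_power_cnj)
  qed
  then have z: "?z = 1 \<longleftrightarrow> [a = b] (mod n)"
    using root_of_unity_power_eq_iff[OF assms] by blast
  have unity: "(root_of_unity n ^ c) ^ n = 1" for c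
  proof -
    have "root_of_unity n ^ (c * n) = root_of_unity n ^ 0"
      by (subst root_of_unity_power_eq_iff[OF assms]) (simp add: cong_def)
    then show ?thesis by (simp add: power_mult)
  qed
  have "?z ^ n = (root_of_unity n ^ a) ^ n * cnj ((root_of_unity n ^ b) ^ n)"
    by (simp add: power_mult_distrib)
  then have "?z ^ n = 1" by (simp only: unity complex_cnj_one mult_1_right)
  then have "?z \<noteq> 1 \<Longrightarrow> (\<Sum>k<n. ?z ^ k) = 0" by (simp add: geometric_sum)
  then show ?thesis unfolding char_power z[symmetric]
    by (cases "?z = 1") (simp_all only: power_one if_True if_False sum_constant card_lessThan mult_1_right simp_thms)
qed

text \<open>The autocorrelation of the coefficients of a unimodular trigonometric polynomial vanishes
  off the origin, and for a Sidon spectrum each of its entries is a single product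
  \<open>u p * cnj (u q)\<close>.\<close>
lemma unimodular_sidon_monomial:
  assumes n: "n > 0" and J: "J \<subseteq> {..<n}" "finite J" and sidon: "sidon_mod n J"
    and unimod: "\<And>k. k < n \<Longrightarrow> norm (\<Sum>j\<in>J. u j * root_of_unity n ^ (j * k)) = 1"
  shows "\<exists>p\<in>J. \<forall>j\<in>J. j \<noteq> p \<longrightarrow> u j = 0"
proof -
  let ?\<omega> = "root_of_unity n"
  let ?F = "\<lambda>k. \<Sum>j\<in>J. u j * ?\<omega> ^ (j * k)"
  have prod0: "u p * cnj (u q) = 0" if pq: "p \<in> J" "q \<in> J" "p \<noteq> q" for p q
  proof -
    have ncong: "\<not> [q = p] (mod n)"
      using cong_less_modulus_unique_nat[of q p n] pq J by auto
    have "?F k * cnj (?F k) = 1" if "k < n" for k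
      using unimod[OF that] complex_norm_square[of "?F k"] by simp
    \<comment> \<open>\<open>?F k * cnj (?F k)\<close> is constantly 1, so its Fourier coefficient
      at the nonzero frequency \<open>p - q\<close> vanishes. Expanding that coefficient leaves the
      pairs \<open>(i, l)\<close> with \<open>i - l\<close> congruent to
      \<open>p - q\<close>.\<close>
    then have "(\<Sum>k<n. (?F k * cnj (?F k)) * (?\<omega> ^ (q * k) * cnj (?\<omega> ^ (p * k)))) =
        (\<Sum>k<n. ?\<omega> ^ (q * k) * cnj (?\<omega> ^ (p * k)))"
      by (intro sum.cong) auto
    also have "\<dots> = 0" using sum_character_orthogonal[OF n] ncong by simp
    finally have "0 = (\<Sum>k<n. (?F k * cnj (?F k)) * (?\<omega> ^ (q * k) * cnj (?\<omega> ^ (p * k))))" ..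
    also have "\<dots> = (\<Sum>k<n. \<Sum>i\<in>J. \<Sum>l\<in>J. u i * cnj (u l) *
        (?\<omega> ^ ((i + q) * k) * cnj (?\<omega> ^ ((p + l) * k))))"
      unfolding cnj_sum sum_product sum_distrib_right
      by (intro sum.cong refl) (simp add: sum_distrib_left distrib_left distrib_right power_add mult_ac)
    also have "\<dots> = (\<Sum>i\<in>J. \<Sum>k<n. \<Sum>l\<in>J. u i * cnj (u l) *
        (?\<omega> ^ ((i + q) * k) * cnj (?\<omega> ^ ((p + l) * k))))"
      by (rule sum.swap)
    also have "\<dots> = (\<Sum>i\<in>J. \<Sum>l\<in>J. \<Sum>k<n. u i * cnj (u l) *
        (?\<omega> ^ ((i + q) * k) * cnj (?\<omega> ^ ((p + l) * k))))"
      by (intro sum.cong refl sum.swap)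
    also have "\<dots> = (\<Sum>i\<in>J. \<Sum>l\<in>J. u i * cnj (u l) *
        (if [i + q = p + l] (mod n) then of_nat n else 0))"
      by (simp only: sum_distrib_left[symmetric] sum_character_orthogonal[OF n])
    also have "\<dots> = (\<Sum>i\<in>J. \<Sum>l\<in>J. if l = q then if i = p then u p * cnj (u q) * of_nat n else 0 else 0)"
    proof (intro sum.cong refl)
      fix i l assume il: "i \<in> J" "l \<in> J"
      have "[i + q = p + l] (mod n) \<longleftrightarrow> l = q \<and> i = p"
      proof
        assume eq: "[i + q = p + l] (mod n)"
        then have "i = p \<or> i = l" using sidon il pq unfolding sidon_mod_def by blast
        \<comment> \<open>The Sidon condition allows \<open>i = p\<close> or \<open>i = l\<close>;
          the second would make \<open>p\<close> and \<open>q\<close> congruent.\<close>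
        moreover have "i \<noteq> l"
        proof
          assume "i = l"
          with eq have "[q + l = p + l] (mod n)" by (simp add: add.commute)
          then show False using ncong by (simp only: cong_add_rcancel_nat)
        qed
        ultimately have "i = p" by simp
        with eq have "[q = l] (mod n)" by (simp only: cong_add_lcancel_nat)
        then have "q = l" using cong_less_modulus_unique_nat[of q l n] il pq J by auto
        with \<open>i = p\<close> show "l = q \<and> i = p" by simp
      qed (simp add: add.commute)
      then show "u i * cnj (u l) * (if [i + q = p + l] (mod n) then of_nat n else 0) =
          (if l = q then if i = p then u p * cnj (u q) * of_nat n else 0 else 0)"
        by simp
    qed
    also have "\<dots> = u p * cnj (u q) * of_nat n"
      using pq J by (simp add: sum.delta)
    finally show ?thesis using n by simp
  qed
  have "\<exists>p\<in>J. u p \<noteq> 0"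
  proof (rule ccontr)
    assume "\<not> (\<exists>p\<in>J. u p \<noteq> 0)"
    then have "?F 0 = 0" by (intro sum.neutral) auto
    with unimod[of 0] n show False by simp
  qed
  then obtain p where "p \<in> J" "u p \<noteq> 0" by blast
  then show ?thesis using prod0[of p] by (intro bexI[of _ p]) force+
qed

lemma nth_sorted_list_bij:
  assumes "finite J" "card J = d"
  shows "bij_betw (\<lambda>i. sorted_list_of_set J ! i) {..<d} J"
  using assms by (intro bij_betw_nth) auto

lemma coprime_cong_totatives:
  fixes a n :: nat
  assumes "coprime a n" "n > 0"
  obtains a' where "a' \<in> totatives n" "[a' = a] (mod n)"
proof (cases "n = 1")
  case True
  then show thesis using that[of 1] by simp
next
  case False
  have cop: "coprime (a mod n) n" using assms by simp
  have "a mod n \<noteq> 0"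
    using cop False by (metis coprime_0_left_iff nat_dvd_1_iff_1)
  then have "a mod n \<in> totatives n"
    using assms cop by (simp add: in_totatives_iff less_imp_le)
  then show thesis using that[of "a mod n"] by simp
qed

text \<open>Inverting \<open>U\<close> writes each character \<open>j'\<close> at
  \<open>\<sigma> k\<close> as a combination of the characters in \<open>J\<close> at
  \<open>k\<close>. Its values are unimodular, so one term \<open>p\<close> survives and
  \<open>j' * \<sigma> k\<close> is affine in \<open>k\<close>. Since \<open>J'\<close> generates,
  \<open>\<sigma>\<close> itself is affine; its slope \<open>a\<close> is a unit because
  \<open>\<sigma>\<close> is surjective, and \<open>a * j'\<close> is congruent to
  \<open>p\<close>.\<close>

lemma frame_equivalent_sidon:
  assumes J: "J \<in> generating_subsets n d" and J': "J' \<in> generating_subsets n d"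
    and n: "n > 0" and sidon: "sidon_mod n J"
    and equiv: "unitarily_equivalent d {..<n} (harmonic_frame n J) {..<n} (harmonic_frame n J')"
  obtains a where "a \<in> totatives n" "J = unit_image n a J'"
proof -
  let ?\<omega> = "root_of_unity n"
  note JD = generating_subsetsD[OF J] and JD' = generating_subsetsD[OF J']
  obtain U \<sigma> where U: "unitary_mat d U" and \<sigma>: "bij_betw \<sigma> {..<n} {..<n}"
    and eq: "\<And>k i. k < n \<Longrightarrow> i < d \<Longrightarrow>
      harmonic_frame n J k i = mat_apply d U (harmonic_frame n J' (\<sigma> k)) i"
    using equiv unfolding unitarily_equivalent_def by blast
  let ?e = "\<lambda>i. sorted_list_of_set J ! i"
  let ?r = "inv_into {..<d} ?e"
  have e: "bij_betw ?e {..<d} J" using nth_sorted_list_bij JD by blast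
  have r: "bij_betw ?r J {..<d}" by (rule bij_betw_inv_into[OF e])
  have er: "?e (?r j) = j" if "j \<in> J" for j using e that by (rule bij_betw_inv_into_right)
  have pull: "\<exists>p\<in>J. \<forall>k<n. [j' * \<sigma> k = j' * \<sigma> 0 + p * k] (mod n)" if j': "j' \<in> J'" for j'
  proof -
    have "j' \<in> (\<lambda>i. sorted_list_of_set J' ! i) ` {..<d}"
      using bij_betw_imp_surj_on[OF nth_sorted_list_bij[OF JD'(2,3)]] j' by simp
    then obtain m where m: "m < d" "sorted_list_of_set J' ! m = j'" by auto
    have exp: "?\<omega> ^ (j' * \<sigma> k) = (\<Sum>j\<in>J. cnj (U (?r j) m) * ?\<omega> ^ (j * k))" if k: "k < n" for k
    proof -
      let ?w = "harmonic_frame n J' (\<sigma> k)"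
      \<comment> \<open>Orthonormality of the columns of \<open>U\<close> isolates coordinate
        \<open>m\<close> of the frame of \<open>J'\<close>.\<close>
      have "(\<Sum>i<d. cnj (U i m) * harmonic_frame n J k i) =
          (\<Sum>i<d. \<Sum>j<d. cnj (U i m) * U i j * ?w j)"
        using eq[OF k] by (simp add: mat_apply_def sum_distrib_left mult.assoc)
      also have "\<dots> = (\<Sum>j<d. \<Sum>i<d. cnj (U i m) * U i j * ?w j)" by (rule sum.swap)
      also have "\<dots> = (\<Sum>j<d. (\<Sum>i<d. cnj (U i m) * U i j) * ?w j)"
        by (simp add: sum_distrib_right)
      also have "\<dots> = (\<Sum>j<d. if m = j then ?w j else 0)"
        using U m(1) by (intro sum.cong) (auto simp: unitary_mat_def)
      also have "\<dots> = ?w m" using m(1) by (simp add: sum.delta)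
      finally have "?w m = (\<Sum>i<d. cnj (U i m) * harmonic_frame n J k i)" ..
      also have "\<dots> = (\<Sum>j\<in>J. cnj (U (?r j) m) * harmonic_frame n J k (?r j))"
        by (rule sum.reindex_bij_betw[OF r, symmetric])
      finally show ?thesis using m(2) er by (simp add: harmonic_frame_def)
    qed
    have "norm (\<Sum>j\<in>J. cnj (U (?r j) m) * ?\<omega> ^ (j * k)) = 1" if "k < n" for k
      unfolding exp[OF that, symmetric] by (rule norm_root_of_unity_power)
    then have "\<exists>p\<in>J. \<forall>j\<in>J. j \<noteq> p \<longrightarrow> cnj (U (?r j) m) = 0"
      by (rule unimodular_sidon_monomial[OF n JD(1,2) sidon])
    then obtain p where p: "p \<in> J" "\<And>j. j \<in> J \<Longrightarrow> j \<noteq> p \<Longrightarrow> cnj (U (?r j) m) = 0"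
      by blast
    have mono: "?\<omega> ^ (j' * \<sigma> k) = cnj (U (?r p) m) * ?\<omega> ^ (p * k)" if "k < n" for k
    proof -
      have "(\<Sum>j\<in>J. cnj (U (?r j) m) * ?\<omega> ^ (j * k)) =
          (\<Sum>j\<in>J. if j = p then cnj (U (?r p) m) * ?\<omega> ^ (p * k) else 0)"
        using p(2) by (intro sum.cong) auto
      then show ?thesis using exp[OF that] p(1) JD(2) by (simp add: sum.delta)
    qed
    have "[j' * \<sigma> k = j' * \<sigma> 0 + p * k] (mod n)" if "k < n" for k
    proof -
      have "?\<omega> ^ (j' * \<sigma> k) = ?\<omega> ^ (j' * \<sigma> 0 + p * k)"
        using mono[OF that] mono[OF n] by (simp add: power_add)
      then show ?thesis using root_of_unity_power_eq_iff[OF n] by blast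
    qed
    with p(1) show ?thesis by blast
  qed
  \<comment> \<open>The slope \<open>\<sigma> 1 - \<sigma> 0\<close> modulo \<open>n\<close>: adding
    \<open>n - \<sigma> 0\<close> avoids truncated subtraction, and \<open>1 mod n\<close> covers
    \<open>n = 1\<close>.\<close>
  define a where "a = \<sigma> (1 mod n) + (n - \<sigma> 0)"
  have \<sigma>0: "\<sigma> 0 < n" using \<sigma> n by (auto simp: bij_betw_def)
  have ap: "\<exists>p\<in>J. [a * j' = p] (mod n) \<and> (\<forall>k<n. [j' * \<sigma> k = j' * \<sigma> 0 + p * k] (mod n))"
    if j': "j' \<in> J'" for j'
  proof -
    obtain p where p: "p \<in> J" "\<And>k. k < n \<Longrightarrow> [j' * \<sigma> k = j' * \<sigma> 0 + p * k] (mod n)"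
      using pull[OF j'] by blast
    have "\<sigma> 0 + a = \<sigma> (1 mod n) + n" using \<sigma>0 by (simp add: a_def)
    then have "j' * (\<sigma> 0 + a) = j' * (\<sigma> (1 mod n) + n)" by simp
    then have "j' * \<sigma> 0 + a * j' = j' * \<sigma> (1 mod n) + j' * n" by (simp only: distrib_left mult.commute)
    also have "[\<dots> = j' * \<sigma> (1 mod n)] (mod n)" by (simp add: cong_def)
    also have "[j' * \<sigma> (1 mod n) = j' * \<sigma> 0 + p * (1 mod n)] (mod n)" using p(2) n by simp
    also have "[j' * \<sigma> 0 + p * (1 mod n) = j' * \<sigma> 0 + p * 1] (mod n)"
      by (intro cong_add cong_scalar_left cong_mod_leftI cong_refl)
    finally have "[a * j' = p] (mod n)" by (simp add: cong_add_lcancel_nat)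
    with p show ?thesis by blast
  qed
  have lin: "[\<sigma> k = \<sigma> 0 + k * a] (mod n)" if k: "k < n" for k
  proof (rule generates_Zn_cancel[OF JD'(4) n])
    fix j' assume "j' \<in> J'"
    then obtain p where p: "[a * j' = p] (mod n)" "[j' * \<sigma> k = j' * \<sigma> 0 + p * k] (mod n)"
      using ap k by blast
    note p(2)
    also have "[j' * \<sigma> 0 + p * k = j' * \<sigma> 0 + (a * j') * k] (mod n)"
      by (intro cong_add cong_scalar_right cong_sym[OF p(1)] cong_refl)
    finally show "[\<sigma> k * j' = (\<sigma> 0 + k * a) * j'] (mod n)" by (simp add: algebra_simps)
  qed
  \<comment> \<open>The point that \<open>\<sigma>\<close> sends to the successor of
    \<open>\<sigma> 0\<close> is an inverse of the slope.\<close>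
  obtain k where k: "k < n" "\<sigma> k = (\<sigma> 0 + 1) mod n"
    using \<sigma> n unfolding bij_betw_def by (metis imageE lessThan_iff mod_less_divisor)
  have "[\<sigma> 0 + k * a = \<sigma> 0 + 1] (mod n)"
    using lin[OF k(1)] k(2) by (simp add: cong_def)
  then have "[a * k = Suc 0] (mod n)" by (simp only: cong_add_lcancel_nat mult.commute One_nat_def)
  then have cop: "coprime a n" by (auto simp: coprime_iff_invertible_nat)
  have "unit_image n a J' \<subseteq> J"
  proof
    fix x assume "x \<in> unit_image n a J'"
    then obtain j' where j': "j' \<in> J'" "x = a * j' mod n" by (auto simp: unit_image_def)
    then obtain p where "p \<in> J" "[a * j' = p] (mod n)" using ap by blast
    then show "x \<in> J" using j' JD(1) by (auto simp: cong_def)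
  qed
  moreover have "card (unit_image n a J') = card J"
    using cop JD' JD by (simp add: card_unit_image)
  ultimately have J_eq: "unit_image n a J' = J" using JD by (intro card_subset_eq)
  obtain a' where "a' \<in> totatives n" "[a' = a] (mod n)"
    using coprime_cong_totatives[OF cop n] .
  then show thesis using J_eq unit_image_cong that by metis
qed

section \<open>Unit multiples of a set give equivalent frames\<close>

lemma bij_betw_mult_mod:
  fixes a n :: nat
  assumes "coprime a n" "n > 0"
  shows "bij_betw (\<lambda>x. a * x mod n) {..<n} {..<n}"
  unfolding bij_betw_def
proof
  show inj: "inj_on (\<lambda>x. a * x mod n) {..<n}" using assms by (intro inj_on_mult_mod) auto
  show "(\<lambda>x. a * x mod n) ` {..<n} = {..<n}"
    using assms by (intro endo_inj_surj inj) auto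
qed

text \<open>The character \<open>a * x\<close> at \<open>k\<close> is the character \<open>x\<close>
  at \<open>a * k\<close>, so the two frames differ by reindexing the vectors and permuting
  coordinates. Stating this against an arbitrary \<open>w\<close> lets whole equivalence classes be
  compared.\<close>

lemma frame_equivalent_unit_image:
  assumes J: "J \<in> generating_subsets n d" and a: "coprime a n" and n: "n > 0"
    and equiv: "unitarily_equivalent d {..<n} (harmonic_frame n J) {..<n} w"
  shows "unitarily_equivalent d {..<n} (harmonic_frame n (unit_image n a J)) {..<n} w"
proof -
  obtain U \<sigma> where U: "unitary_mat d U" and \<sigma>: "bij_betw \<sigma> {..<n} {..<n}"
    and eq: "\<And>k i. k < n \<Longrightarrow> i < d \<Longrightarrow> harmonic_frame n J k i = mat_apply d U (w (\<sigma> k)) i"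
    using equiv unfolding unitarily_equivalent_def by blast
  let ?K = "unit_image n a J" and ?g = "\<lambda>x. a * x mod n"
  note JD = generating_subsetsD[OF J]
  note KD = generating_subsetsD[OF unit_image_generating[OF J a n]]
  let ?eJ = "\<lambda>i. sorted_list_of_set J ! i" and ?eK = "\<lambda>i. sorted_list_of_set ?K ! i"
  have eJ: "bij_betw ?eJ {..<d} J" and eK: "bij_betw ?eK {..<d} ?K"
    using nth_sorted_list_bij JD KD by blast+
  have g: "bij_betw ?g J ?K"
    using inj_on_mult_mod[OF a JD(1)] by (simp add: bij_betw_def unit_image_def)
  \<comment> \<open>Multiplication by \<open>a\<close> disturbs the sorted order:
    \<open>\<pi>\<close> takes the position of \<open>a * x mod n\<close> in \<open>?K\<close> to
    the position of \<open>x\<close> in \<open>J\<close>.\<close>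
  define \<pi> where "\<pi> = inv_into {..<d} ?eJ \<circ> (inv_into J ?g \<circ> ?eK)"
  have \<pi>: "bij_betw \<pi> {..<d} {..<d}"
    unfolding \<pi>_def by (intro bij_betw_trans[OF bij_betw_trans[OF eK bij_betw_inv_into[OF g]]
        bij_betw_inv_into[OF eJ]])
  have \<pi>_less: "\<pi> i < d" if "i < d" for i using \<pi> that by (auto simp: bij_betw_def)
  have index: "?eK i = a * ?eJ (\<pi> i) mod n" if "i < d" for i
  proof -
    have K: "?eK i \<in> ?K" using eK that by (auto simp: bij_betw_def)
    then have "inv_into J ?g (?eK i) \<in> J"
      using bij_betw_inv_into[OF g] by (auto simp: bij_betw_def)
    then show ?thesis
      using bij_betw_inv_into_right[OF eJ] bij_betw_inv_into_right[OF g K] by (simp add: \<pi>_def)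
  qed
  have frame: "harmonic_frame n ?K k i = harmonic_frame n J (?g k) (\<pi> i)" if "i < d" for k i
    unfolding harmonic_frame_def root_of_unity_power_eq_iff[OF n] index[OF that]
    by (simp add: cong_def mod_mult_left_eq mod_mult_right_eq mult_ac)
  have "unitary_mat d (\<lambda>i. U (\<pi> i))"
    using U unfolding unitary_mat_def
    by (subst sum.reindex_bij_betw[OF \<pi>, where g = "\<lambda>k. cnj (U k i) * U k j" for i j])
  moreover have "bij_betw (\<sigma> \<circ> ?g) {..<n} {..<n}"
    by (rule bij_betw_trans[OF bij_betw_mult_mod[OF a n] \<sigma>])
  moreover have "harmonic_frame n ?K k i = mat_apply d (\<lambda>i. U (\<pi> i)) (w ((\<sigma> \<circ> ?g) k)) i"
    if "k < n" "i < d" for k i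
    using frame[OF that(2), of k] eq[OF _ \<pi>_less[OF that(2)], of "?g k"] n
    by (simp add: mat_apply_def)
  ultimately show ?thesis
    unfolding unitarily_equivalent_def by blast
qed

lemma frame_equivalent_refl: "unitarily_equivalent d {..<n} v {..<n} v"
  unfolding unitarily_equivalent_def
proof (intro exI conjI)
  have "(\<Sum>k<d. cnj (if k = i then 1 else 0) * (if k = j then 1 else 0 :: complex)) =
      (\<Sum>k<d. if k = i then if i = j then 1 else 0 else 0)" for i j
    by (intro sum.cong) auto
  then show "unitary_mat d (\<lambda>i j. if i = j then 1 else 0)"
    by (simp add: unitary_mat_def)
  show "bij_betw id {..<n} {..<n}" by simp
  show "\<forall>k\<in>{..<n}. \<forall>i<d. v k i = mat_apply d (\<lambda>i j. if i = j then 1 else 0) (v (id k)) i"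
    by (simp add: mat_apply_def if_distribR if_distrib[where f = "\<lambda>x. x * _"] cong: if_cong)
qed

lemma frame_equiv_class_unit_image:
  assumes J: "J \<in> generating_subsets n d" and a: "coprime a n" and n: "n > 0"
  shows "frame_equiv_rel n d `` {unit_image n a J} = frame_equiv_rel n d `` {J}"
proof -
  let ?E = "\<lambda>J J'. unitarily_equivalent d {..<n} (harmonic_frame n J) {..<n} (harmonic_frame n J')"
  have K: "unit_image n a J \<in> generating_subsets n d" by (rule unit_image_generating[OF J a n])
  obtain b where "coprime b n" "unit_image n b (unit_image n a J) = J"
    using unit_image_inverse[OF a generating_subsetsD(1)[OF J]] .
  then have "?E (unit_image n a J) J' \<longleftrightarrow> ?E J J'" for J'
    using frame_equivalent_unit_image[OF J a n] frame_equivalent_unit_image[OF K _ n] by metis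
  then show ?thesis using J K by (auto simp: frame_equiv_rel_def)
qed

lemma frame_equiv_rel_unit_image:
  assumes "J \<in> generating_subsets n d" "coprime a n" "n > 0"
  shows "(unit_image n a J, J) \<in> frame_equiv_rel n d"
  using assms unit_image_generating frame_equivalent_unit_image[OF assms frame_equivalent_refl]
  by (simp add: frame_equiv_rel_def)

text \<open>A generating singleton consists of a unit, and the units permute these singletons
  transitively.\<close>

lemma h_count_one:
  assumes n: "n \<ge> 1"
  shows "h_count n 1 = 1"
proof -
  let ?S = "generating_subsets n 1" and ?R = "frame_equiv_rel n 1"
  have pos: "n > 0" using n by simp
  \<comment> \<open>For \<open>n = 1\<close> this is \<open>{0}\<close>, which generates the trivial
    group.\<close>
  have "{1 mod n} \<in> ?S"
    using pos by (simp add: generating_subsets_def generates_Zn_iff_Gcd)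
  moreover have "?R `` {J} = ?S" if J: "J \<in> ?S" for J
  proof
    show "?R `` {J} \<subseteq> ?S" by (auto simp: frame_equiv_rel_def)
    show "?S \<subseteq> ?R `` {J}"
    proof
      fix J' assume J': "J' \<in> ?S"
      obtain j j' where j: "J = {j}" "J' = {j'}"
        using J J' by (auto simp: generating_subsets_def card_1_singleton_iff)
      have "j < n" "coprime j n" "coprime j' n"
        using J J' pos unfolding j by (auto simp: generating_subsets_def generates_Zn_iff_Gcd)
      obtain b where b: "coprime b n" "[b * j' = 1] (mod n)"
        using coprime_inverse_mod \<open>coprime j' n\<close> by blast
      have "[j * b * j' = j * 1] (mod n)"
        using cong_scalar_left[OF b(2), of j] by (simp only: mult.assoc)
      then have "unit_image n (j * b) J' = J"
        using \<open>j < n\<close> by (simp add: unit_image_def j cong_def)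
      moreover have "coprime (j * b) n" using b(1) \<open>coprime j n\<close> by simp
      ultimately show "J' \<in> ?R `` {J}"
        using frame_equiv_rel_unit_image[OF J' _ pos] by force
    qed
  qed
  ultimately have "?S // ?R = {?S}" unfolding quotient_def by blast
  then show ?thesis by (simp add: h_count_def)
qed

subsection \<open>Sets with an additive coincidence or a nontrivial stabiliser\<close>

lemma card_UN_bounded:
  assumes "finite A" "\<And>i. i \<in> A \<Longrightarrow> card (f i) \<le> K"
  shows "card (\<Union>i\<in>A. f i) \<le> card A * K"
proof -
  have "card (\<Union>i\<in>A. f i) \<le> (\<Sum>i\<in>A. card (f i))" by (rule card_UN_le[OF assms(1)])
  also have "\<dots> \<le> card A * K" using sum_bounded_above[of A "\<lambda>i. card (f i)" K] assms(2) by simp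
  finally show ?thesis .
qed

lemma card_le_one:
  assumes "\<And>x y. x \<in> A \<Longrightarrow> y \<in> A \<Longrightarrow> x = y"
  shows "card A \<le> 1"
  using assms by (cases "finite A") (auto simp: card_le_Suc0_iff_eq)

text \<open>\<open>J\<close> is recovered as \<open>insert x Y\<close> from one of at most
  \<open>n ^ (d - 1)\<close> sets \<open>Y\<close> and one of at most \<open>K\<close> elements
  \<open>x\<close> of \<open>D Y\<close>. With \<open>K\<close> small this saves almost a factor
  \<open>n\<close> over all \<open>d\<close>-sets.\<close>

lemma card_determined_le:
  fixes D :: "nat set \<Rightarrow> nat set"
  assumes D: "\<And>Y. Y \<subseteq> {..<n} \<Longrightarrow> card Y = d - 1 \<Longrightarrow> finite (D Y) \<and> card (D Y) \<le> K"
    and B: "\<And>J. J \<in> B \<Longrightarrow> J \<subseteq> {..<n} \<and> card J = d \<and> (\<exists>x\<in>J. x \<in> D (J - {x}))"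
  shows "card B \<le> K * n ^ (d - 1)"
proof -
  let ?P = "{Y. Y \<subseteq> {..<n} \<and> card Y = d - 1}"
  have fin: "finite ?P" by (rule finite_subset[of _ "Pow {..<n}"]) auto
  have "B \<subseteq> (\<Union>Y\<in>?P. (\<lambda>x. insert x Y) ` D Y)"
  proof
    fix J assume "J \<in> B"
    then obtain x where x: "J \<subseteq> {..<n}" "card J = d" "x \<in> J" "x \<in> D (J - {x})"
      using B by blast
    then have "J - {x} \<in> ?P" "J = insert x (J - {x})" by auto
    then show "J \<in> (\<Union>Y\<in>?P. (\<lambda>x. insert x Y) ` D Y)" using x(4) by blast
  qed
  then have "card B \<le> card (\<Union>Y\<in>?P. (\<lambda>x. insert x Y) ` D Y)"
    using fin D by (intro card_mono) auto
  also have "\<dots> \<le> card ?P * K"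
  proof (rule card_UN_bounded[OF fin])
    fix Y assume "Y \<in> ?P"
    then have "finite (D Y)" "card (D Y) \<le> K" using D by auto
    then show "card ((\<lambda>x. insert x Y) ` D Y) \<le> K" using card_image_le le_trans by blast
  qed
  also have "card ?P = n choose (d - 1)" using n_subsets[of "{..<n}" "d - 1"] by simp
  also have "\<dots> \<le> n ^ (d - 1)"
    by (cases "d - 1 \<le> n") (simp_all add: binomial_le_pow binomial_eq_0)
  finally show ?thesis by (simp add: mult.commute)
qed

text \<open>Measured from the least solution \<open>y\<close>, the difference
  \<open>2 * x - 2 * y\<close> is a multiple of \<open>n\<close> below \<open>2 * n\<close>, hence 0
  or \<open>n\<close>.\<close>

lemma card_double_cong_le:
  fixes n c :: nat
  shows "card {x. x < n \<and> [2 * x = c] (mod n)} \<le> 2"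
proof (cases "{x. x < n \<and> [2 * x = c] (mod n)} = {}")
  case False
  let ?A = "{x. x < n \<and> [2 * x = c] (mod n)}"
  define y where "y = Min ?A"
  have y: "y \<in> ?A" "\<And>x. x \<in> ?A \<Longrightarrow> y \<le> x"
    using Min_in[of ?A] Min_le[of ?A] False by (auto simp: y_def)
  have "?A \<subseteq> {y, y + n div 2}"
  proof
    fix x assume x: "x \<in> ?A"
    then have "[2 * x = 2 * y] (mod n)" using y(1) by (auto simp: cong_def)
    then obtain q where "2 * x = q * n + 2 * y"
      using y(2)[OF x] by (auto simp: cong_le_nat)
    moreover have "2 * x < 2 * n + 2 * y" using x by auto
    ultimately have "q * n < 2 * n" by linarith
    then have "q = 0 \<or> q = 1" by auto
    then show "x \<in> {y, y + n div 2}" using \<open>2 * x = q * n + 2 * y\<close> by auto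
  qed
  then have "card ?A \<le> card {y, y + n div 2}" by (intro card_mono) auto
  also have "\<dots> \<le> 2" by (simp add: card_insert_if)
  finally show ?thesis .
qed (simp only: card.empty le0)

text \<open>Let \<open>g\<close> be the common gcd. As \<open>n div g\<close> is coprime to
  \<open>(a + 1) div g\<close>, it divides \<open>a - 1\<close>, and likewise \<open>b - 1\<close>.
  Hence \<open>a - b\<close> is divisible by \<open>g\<close> and \<open>n div g\<close>, so by
  their lcm; their gcd divides \<open>(a + 1) - (a - 1) = 2\<close>, and gcd times lcm is
  \<open>n\<close> up to sign.\<close>

lemma involution_gcd:
  fixes a b n :: int
  assumes "n \<noteq> 0" "n dvd (a - 1) * (a + 1)" "n dvd (b - 1) * (b + 1)" "gcd (a + 1) n = gcd (b + 1) n"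
  shows "n dvd 2 * (a - b)"
proof -
  define g where "g = gcd (a + 1) n"
  have "g \<noteq> 0" using assms(1) by (simp add: g_def)
  have cofactor: "n div g dvd c - 1" if "gcd (c + 1) n = g" "n dvd (c - 1) * (c + 1)" for c
  proof -
    have gd: "g dvd n" "g dvd c + 1" using that(1) by auto
    have "(n div g) * g dvd ((c - 1) * ((c + 1) div g)) * g"
      using that(2) gd by (simp add: mult.assoc)
    then have "n div g dvd (c - 1) * ((c + 1) div g)" using \<open>g \<noteq> 0\<close> by simp
    moreover have "coprime (n div g) ((c + 1) div g)"
      using div_gcd_coprime[of "c + 1" n] that(1) \<open>g \<noteq> 0\<close> assms(1)
      by (simp add: coprime_commute)
    ultimately show ?thesis by (simp add: coprime_dvd_mult_left_iff)
  qed
  let ?m = "n div g"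
  have n: "n = g * ?m" by (simp add: g_def)
  have am: "?m dvd a - 1" and bm: "?m dvd b - 1" using cofactor assms by (auto simp: g_def)
  have ag: "g dvd a + 1" and bg: "g dvd b + 1"
    unfolding g_def by simp (simp add: assms(4))
  have "g dvd a - b" using dvd_diff[OF ag bg] by simp
  moreover have "?m dvd a - b" using dvd_diff[OF am bm] by simp
  ultimately have "lcm g ?m dvd a - b" by simp
  moreover have "gcd g ?m dvd 2"
  proof -
    have "gcd g ?m dvd a + 1" "gcd g ?m dvd a - 1" using ag am by (auto intro: dvd_trans)
    then have "gcd g ?m dvd (a + 1) - (a - 1)" by (rule dvd_diff)
    then show ?thesis by simp
  qed
  ultimately have "gcd g ?m * lcm g ?m dvd 2 * (a - b)" by (rule mult_dvd_mono[rotated])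
  then show ?thesis using n by (metis abs_dvd_iff abs_mult lcm_mult_gcd mult.commute prod_gcd_lcm_int)
qed

text \<open>Sort the square roots of 1 by the divisor \<open>gcd (a + 1) n\<close>. By
  \<open>involution_gcd\<close> those sharing a divisor have congruent doubles, so there are at most
  two of them.\<close>

lemma card_involutions_le:
  fixes n :: nat
  assumes "n > 0"
  shows "card {a. a < n \<and> [a * a = 1] (mod n)} \<le> card {g. g dvd n} * 2"
proof -
  let ?I = "{a. a < n \<and> [a * a = 1] (mod n)}"
  have fin: "finite {g. g dvd n}"
    by (rule finite_subset[of _ "{..n}"]) (use assms in \<open>auto dest: dvd_imp_le\<close>)
  have "?I = (\<Union>g\<in>{g. g dvd n}. {a \<in> ?I. gcd (a + 1) n = g})" by auto
  also have "card \<dots> \<le> card {g. g dvd n} * 2"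
  proof (rule card_UN_bounded[OF fin])
    fix g assume "g \<in> {g. g dvd n}"
    show "card {a \<in> ?I. gcd (a + 1) n = g} \<le> 2"
    proof (cases "{a \<in> ?I. gcd (a + 1) n = g} = {}")
      case False
      have dvd: "int n dvd (int c - 1) * (int c + 1)" if "c \<in> ?I" for c
      proof -
        have "[int (c * c) = int 1] (mod int n)" using that by (simp only: cong_int_iff mem_Collect_eq)
        then show ?thesis by (simp add: cong_iff_dvd_diff algebra_simps)
      qed
      have gcd_int: "gcd (int c + 1) (int n) = int g" if "gcd (c + 1) n = g" for c
        using that by (metis gcd_int_int_eq of_nat_1 of_nat_add)
      from False obtain a where a: "a \<in> {a \<in> ?I. gcd (a + 1) n = g}" by blast
      have "{a \<in> ?I. gcd (a + 1) n = g} \<subseteq> {x. x < n \<and> [2 * x = 2 * a] (mod n)}"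
      proof
        fix b assume b: "b \<in> {a \<in> ?I. gcd (a + 1) n = g}"
        have "int n dvd 2 * (int b - int a)"
          using a b dvd gcd_int assms by (intro involution_gcd) auto
        then have "[int (2 * b) = int (2 * a)] (mod int n)"
          by (simp add: cong_iff_dvd_diff right_diff_distrib)
        then show "b \<in> {x. x < n \<and> [2 * x = 2 * a] (mod n)}"
          using b by (simp only: cong_int_iff mem_Collect_eq)
      qed
      then have "card {a \<in> ?I. gcd (a + 1) n = g} \<le> card {x. x < n \<and> [2 * x = 2 * a] (mod n)}"
        by (intro card_mono) auto
      also have "\<dots> \<le> 2" by (rule card_double_cong_le)
      finally show ?thesis .
    qed (simp only: card.empty le0)
  qed
  finally show ?thesis .
qed

text \<open>Quantifying over \<open>totatives n\<close> takes one representative of each unit; the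
  identity is then represented by \<open>1\<close> even for \<open>n = 1\<close>.\<close>

definition good_set :: "nat \<Rightarrow> nat set \<Rightarrow> bool" where
  "good_set n J \<longleftrightarrow> sidon_mod n J \<and> (\<forall>a\<in>totatives n. unit_image n a J = J \<longrightarrow> a = 1)"

text \<open>In every set that is not good, some element is determined, up to few choices, by the
  remaining elements.\<close>
definition dependents :: "nat \<Rightarrow> nat set \<Rightarrow> nat set" where
  "dependents n Y =
     {x. x < n \<and> (\<exists>b\<in>Y. \<exists>c\<in>Y. \<exists>e\<in>Y. [x + e = b + c] (mod n))} \<union>
     {x. x < n \<and> (\<exists>b\<in>Y. [2 * x = 2 * b] (mod n))} \<union>
     {z. z < n \<and> (\<exists>x\<in>Y. \<exists>y\<in>Y. \<exists>a. [a * x = y] (mod n) \<and> [a * y = z] (mod n))} \<union>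
     {y. y < n \<and> (\<exists>x\<in>Y. \<exists>a<n. [a * a = 1] (mod n) \<and> [a * x = y] (mod n))}"

lemma finite_dependents: "finite (dependents n Y)"
  by (rule finite_subset[of _ "{..<n}"]) (auto simp: dependents_def)

text \<open>The four terms match the four parts of \<open>dependents\<close>: one element per
  triple, at most two per \<open>b\<close>, one per pair \<open>(x, y)\<close>, and one per pair of
  an element and a square root of 1.\<close>

lemma card_dependents_le:
  assumes Y: "finite Y" "card Y = k"
  shows "card (dependents n Y) \<le>
    k ^ 3 + 2 * k + k ^ 2 + k * card {a. a < n \<and> [a * a = 1] (mod n)}"
proof -
  let ?I = "{a. a < n \<and> [a * a = 1] (mod n)}"
  let ?D1 = "\<Union>(b, c, e)\<in>Y \<times> Y \<times> Y. {x. x < n \<and> [x + e = b + c] (mod n)}"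
  let ?D2 = "\<Union>b\<in>Y. {x. x < n \<and> [2 * x = 2 * b] (mod n)}"
  let ?D3 = "\<Union>(x, y)\<in>Y \<times> Y. {z. z < n \<and> (\<exists>a. [a * x = y] (mod n) \<and> [a * y = z] (mod n))}"
  let ?D4 = "(\<lambda>(x, a). a * x mod n) ` (Y \<times> ?I)"
  have "card ?D1 \<le> card (Y \<times> Y \<times> Y) * 1"
  proof (rule card_UN_bounded)
    fix t assume "t \<in> Y \<times> Y \<times> Y"
    show "card (case t of (b, c, e) \<Rightarrow> {x. x < n \<and> [x + e = b + c] (mod n)}) \<le> 1"
    proof (rule card_le_one)
      fix x y assume "x \<in> (case t of (b, c, e) \<Rightarrow> {x. x < n \<and> [x + e = b + c] (mod n)})"
        "y \<in> (case t of (b, c, e) \<Rightarrow> {x. x < n \<and> [x + e = b + c] (mod n)})"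
      then obtain b c e where *: "x < n" "y < n" "[x + e = b + c] (mod n)" "[y + e = b + c] (mod n)"
        by (cases t) auto
      then have "[x + e = y + e] (mod n)" by (simp add: cong_def)
      then have "[x = y] (mod n)" by (simp only: cong_add_rcancel_nat)
      then show "x = y" using *(1,2) by (rule cong_less_modulus_unique_nat)
    qed
  qed (use Y in auto)
  then have 1: "card ?D1 \<le> k ^ 3" using Y by (simp add: card_cartesian_product power3_eq_cube)
  have "card ?D2 \<le> card Y * 2"
    by (rule card_UN_bounded[OF Y(1)]) (rule card_double_cong_le)
  then have 2: "card ?D2 \<le> 2 * k" using Y by simp
  have "card ?D3 \<le> card (Y \<times> Y) * 1"
  proof (rule card_UN_bounded)
    fix t assume "t \<in> Y \<times> Y"
    show "card (case t of (x, y) \<Rightarrow>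
      {z. z < n \<and> (\<exists>a. [a * x = y] (mod n) \<and> [a * y = z] (mod n))}) \<le> 1"
    proof (rule card_le_one)
      fix z w assume "z \<in> (case t of (x, y) \<Rightarrow>
          {z. z < n \<and> (\<exists>a. [a * x = y] (mod n) \<and> [a * y = z] (mod n))})"
        "w \<in> (case t of (x, y) \<Rightarrow>
          {z. z < n \<and> (\<exists>a. [a * x = y] (mod n) \<and> [a * y = z] (mod n))})"
      then obtain x y a b where *: "z < n" "w < n" "[a * x = y] (mod n)" "[a * y = z] (mod n)"
        "[b * x = y] (mod n)" "[b * y = w] (mod n)"
        by (cases t) auto
      \<comment> \<open>The multipliers \<open>a\<close> and \<open>b\<close> may differ, but both
        send \<open>x\<close> to \<open>y\<close>, and commutativity makes them agree on
        \<open>y\<close>.\<close>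
      have "[z = a * y] (mod n)" by (rule cong_sym[OF *(4)])
      also have "[a * y = a * (b * x)] (mod n)" by (intro cong_scalar_left cong_sym[OF *(5)])
      also have "a * (b * x) = b * (a * x)" by simp
      also have "[b * (a * x) = b * y] (mod n)" by (intro cong_scalar_left *(3))
      also have "[b * y = w] (mod n)" by (rule *(6))
      finally show "z = w" using *(1,2) by (rule cong_less_modulus_unique_nat)
    qed
  qed (use Y in auto)
  then have 3: "card ?D3 \<le> k ^ 2" using Y by (simp add: card_cartesian_product power2_eq_square)
  have "card ?D4 \<le> card (Y \<times> ?I)" using Y by (intro card_image_le) auto
  then have 4: "card ?D4 \<le> k * card ?I" using Y by (simp add: card_cartesian_product)
  have "dependents n Y \<subseteq> ?D1 \<union> ?D2 \<union> ?D3 \<union> ?D4"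
  proof
    fix z assume "z \<in> dependents n Y"
    then consider
        "z < n" "\<exists>b\<in>Y. \<exists>c\<in>Y. \<exists>e\<in>Y. [z + e = b + c] (mod n)"
      | "z < n" "\<exists>b\<in>Y. [2 * z = 2 * b] (mod n)"
      | "z < n" "\<exists>x\<in>Y. \<exists>y\<in>Y. \<exists>a. [a * x = y] (mod n) \<and> [a * y = z] (mod n)"
      | "z < n" "\<exists>x\<in>Y. \<exists>a<n. [a * a = 1] (mod n) \<and> [a * x = z] (mod n)"
      unfolding dependents_def by (elim UnE) simp_all
    then show "z \<in> ?D1 \<union> ?D2 \<union> ?D3 \<union> ?D4"
    proof cases
      case 1 then have "z \<in> ?D1" by simp
      then show ?thesis by (simp only: Un_iff simp_thms)
    next
      case 2 then have "z \<in> ?D2" by simp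
      then show ?thesis by (simp only: Un_iff simp_thms)
    next
      case 3 then have "z \<in> ?D3" by simp
      then show ?thesis by (simp only: Un_iff simp_thms)
    next
      case 4
      then obtain x a where "x \<in> Y" "a \<in> ?I" "[a * x = z] (mod n)" by blast
      then have "z \<in> ?D4"
        using 4(1) by (intro image_eqI[of _ _ "(x, a)"]) (simp_all add: cong_def)
      then show ?thesis by (simp only: Un_iff simp_thms)
    qed
  qed
  moreover have "finite (?D1 \<union> ?D2 \<union> ?D3 \<union> ?D4)" using Y by auto
  ultimately have "card (dependents n Y) \<le> card (?D1 \<union> ?D2 \<union> ?D3 \<union> ?D4)"
    by (rule card_mono[rotated])
  also have "\<dots> \<le> card ?D1 + card ?D2 + card ?D3 + card ?D4"
    by (meson add_le_mono card_Un_le le_refl le_trans)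
  also have "\<dots> \<le> k ^ 3 + 2 * k + k ^ 2 + k * card ?I" by (intro add_mono 1 2 3 4)
  finally show ?thesis .
qed

text \<open>A failure of the Sidon condition expresses one element through others. For a nontrivial
  stabilising unit \<open>a\<close>, either some \<open>a * a * x\<close> differs from
  \<open>x\<close> and is determined by \<open>x\<close> and \<open>a * x\<close>, or
  \<open>a * a\<close> fixes \<open>J\<close> pointwise, so \<open>a\<close> is a square root of 1
  and sends some \<open>x\<close> to a different element.\<close>

lemma not_good_dependent:
  assumes J: "J \<in> generating_subsets n d" and n: "n > 0" and bad: "\<not> good_set n J"
  shows "\<exists>x\<in>J. x \<in> dependents n (J - {x})"
proof (cases "sidon_mod n J")
  case False
  note JD = generating_subsetsD[OF J]
  obtain a b c e where J: "a \<in> J" "b \<in> J" "c \<in> J" "e \<in> J"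
    and eq: "[a + e = b + c] (mod n)" and neq: "a \<noteq> b" "a \<noteq> c"
    using False unfolding sidon_mod_def by blast
  have less: "a < n" "b < n" using J JD by auto
  \<comment> \<open>An element standing only once in the relation can be solved for:
    \<open>a\<close> in the first case, \<open>b\<close> in the second. In the third case only
    \<open>2 * a\<close> and \<open>2 * b\<close> remain.\<close>
  consider "e \<noteq> a" | "e = a" "b \<noteq> c" | "e = a" "b = c" by blast
  then show ?thesis
  proof cases
    case 1
    then have "a \<in> dependents n (J - {a})"
      unfolding dependents_def using J eq neq less by blast
    with J show ?thesis by blast
  next
    case 2
    then have "[b + c = a + a] (mod n)" using eq by (simp add: cong_sym)
    then have "b \<in> dependents n (J - {b})"
      unfolding dependents_def using J 2 neq less by blast
    with J show ?thesis by blast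
  next
    case 3
    then have "[2 * a = 2 * b] (mod n)" using eq by (simp only: mult_2)
    then have "a \<in> dependents n (J - {a})"
      unfolding dependents_def using J neq less by blast
    with J show ?thesis by blast
  qed
next
  case True
  note JD = generating_subsetsD[OF J]
  obtain a where a: "a \<in> totatives n" "unit_image n a J = J" "a \<noteq> 1"
    using bad True unfolding good_set_def by blast
  have "n \<noteq> 1" using a by auto
  then have an: "a < n" "coprime a n" using a(1) n totatives_less[of a n] by (auto simp: in_totatives_iff)
  have T: "a * x mod n \<in> J" if "x \<in> J" for x
    using a(2) that unfolding unit_image_def by blast
  show ?thesis
  proof (cases "\<exists>x\<in>J. a * (a * x mod n) mod n \<noteq> x")
    case True
    then obtain x where x: "x \<in> J" "a * (a * x mod n) mod n \<noteq> x" by blast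
    let ?y = "a * x mod n" let ?z = "a * ?y mod n"
    \<comment> \<open>Both \<open>x\<close> and \<open>?y\<close> must survive the removal of
      \<open>?z\<close>. If \<open>?z = ?y\<close>, injectivity would give \<open>?y = x\<close> and
      then \<open>?z = x\<close>.\<close>
    have "?z \<noteq> ?y"
    proof
      assume "?z = ?y"
      then have "?y = x" using inj_on_mult_mod[OF an(2) JD(1)] T[OF x(1)] x(1)
        by (auto simp: inj_on_def)
      with \<open>?z = ?y\<close> x(2) show False by simp
    qed
    have "[a * x = ?y] (mod n)" "[a * ?y = ?z] (mod n)" "?z < n"
      using n by (simp_all only: cong_mod_right cong_refl mod_less_divisor)
    moreover have "x \<in> J - {?z}" "?y \<in> J - {?z}" using x T \<open>?z \<noteq> ?y\<close> by auto
    ultimately have "\<exists>u\<in>J - {?z}. \<exists>v\<in>J - {?z}. \<exists>b. [b * u = v] (mod n) \<and> [b * v = ?z] (mod n)"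
      by (intro bexI[of _ x] bexI[of _ ?y] exI[of _ a] conjI)
    then have "?z \<in> dependents n (J - {?z})"
      unfolding dependents_def using \<open>?z < n\<close> by (intro UnI1[OF UnI2] CollectI conjI)
    with T x(1) show ?thesis by blast
  next
    case False
    have "[(a * a) * x = 1 * x] (mod n)" if "x \<in> J" for x
      using False that JD(1) by (auto simp: cong_def mult.assoc mod_mult_right_eq)
    then have inv: "[a * a = 1] (mod n)" by (rule generates_Zn_cancel[OF JD(4) n])
    \<comment> \<open>A unit fixing every element of a generating set is 1.\<close>
    have "\<exists>x\<in>J. a * x mod n \<noteq> x"
    proof (rule ccontr)
      assume "\<not> (\<exists>x\<in>J. a * x mod n \<noteq> x)"
      then have "[a * x = 1 * x] (mod n)" if "x \<in> J" for x using that JD(1) by (auto simp: cong_def)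
      then have "[a = 1] (mod n)" by (rule generates_Zn_cancel[OF JD(4) n])
      then show False using totatives_cong_eq[of a 1 n] a n by simp
    qed
    then obtain x where x: "x \<in> J" "a * x mod n \<noteq> x" by blast
    let ?y = "a * x mod n"
    have "[a * x = ?y] (mod n)" "?y < n"
      using n by (simp_all only: cong_mod_right cong_refl mod_less_divisor)
    moreover have "x \<in> J - {?y}" using x by auto
    ultimately have "\<exists>u\<in>J - {?y}. \<exists>b<n. [b * b = 1] (mod n) \<and> [b * u = ?y] (mod n)"
      using an(1) inv by (intro bexI[of _ x] exI[of _ a] conjI)
    then have "?y \<in> dependents n (J - {?y})"
      unfolding dependents_def using \<open>?y < n\<close> by (intro UnI2 CollectI conjI)
    with T x(1) show ?thesis by blast
  qed
qed

lemma card_not_good_le: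
  assumes n: "n > 0" and d: "d \<ge> 1"
  shows "card {J \<in> generating_subsets n d. \<not> good_set n J} \<le>
    (d ^ 3 + 2 * d + d ^ 2 + d * (card {g. g dvd n} * 2)) * n ^ (d - 1)"
proof (rule card_determined_le)
  fix Y assume Y: "Y \<subseteq> {..<n}" "card Y = d - 1"
  have "card (dependents n Y) \<le>
      (d - 1) ^ 3 + 2 * (d - 1) + (d - 1) ^ 2 + (d - 1) * card {a. a < n \<and> [a * a = 1] (mod n)}"
    using Y by (intro card_dependents_le) (auto intro: finite_subset)
  also have "\<dots> \<le> d ^ 3 + 2 * d + d ^ 2 + d * (card {g. g dvd n} * 2)"
  proof -
    have "(d - 1) ^ 3 \<le> d ^ 3" "(d - 1) ^ 2 \<le> d ^ 2" by (simp_all add: power_mono)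
    moreover have "(d - 1) * card {a. a < n \<and> [a * a = 1] (mod n)} \<le> d * (card {g. g dvd n} * 2)"
      by (intro mult_le_mono card_involutions_le n) simp
    ultimately show ?thesis by linarith
  qed
  finally show "finite (dependents n Y) \<and>
      card (dependents n Y) \<le> d ^ 3 + 2 * d + d ^ 2 + d * (card {g. g dvd n} * 2)"
    using finite_dependents by blast
next
  fix J assume "J \<in> {J \<in> generating_subsets n d. \<not> good_set n J}"
  then show "J \<subseteq> {..<n} \<and> card J = d \<and> (\<exists>x\<in>J. x \<in> dependents n (J - {x}))"
    using generating_subsetsD[of J n d] not_good_dependent[of J n d] n by simp
qed

subsection \<open>Generating sets and the divisor bound\<close>

lemma card_multiples_less:
  assumes "m dvd n" "n > 0"
  shows "card {x. x < n \<and> m dvd x} = n div m"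
proof -
  have m: "m > 0" using assms by (auto intro: Nat.gr0I)
  have "{x. x < n \<and> m dvd x} = (\<lambda>k. m * k) ` {..<n div m}"
    using assms m by (auto simp: image_iff elim!: dvdE)
  moreover have "inj_on (\<lambda>k. m * k) {..<n div m}" using m by (auto simp: inj_on_def)
  ultimately show ?thesis by (simp add: card_image)
qed

text \<open>The extra divisor \<open>m\<close> lets the sieve be proved by induction, removing one prime at a time.\<close>
lemma card_sieved_lists:
  fixes n d m :: nat
  assumes n: "n > 0" and "finite S" "\<And>p. p \<in> S \<Longrightarrow> prime p \<and> p dvd n \<and> \<not> p dvd m" "m dvd n"
  shows "real (card {xs. length xs = d \<and> set xs \<subseteq> {x. x < n \<and> m dvd x} \<and>
             (\<forall>p\<in>S. \<not> p dvd Gcd (set xs))}) =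
           (real n / real m) ^ d * (\<Prod>p\<in>S. 1 - 1 / real p ^ d)"
  using assms(2-)
proof (induction S arbitrary: m)
  case empty
  have "finite {x. x < n \<and> m dvd x}" by simp
  then have "card {xs. length xs = d \<and> set xs \<subseteq> {x. x < n \<and> m dvd x}} = (n div m) ^ d"
    using card_lists_length_eq[of "{x. x < n \<and> m dvd x}" d] card_multiples_less[OF empty.prems(2) n]
    by (simp add: conj_commute)
  then show ?case using empty.prems by (simp add: real_of_nat_div)
next
  case (insert p S)
  let ?L = "\<lambda>m S. {xs. length xs = d \<and> set xs \<subseteq> {x. x < n \<and> m dvd x} \<and>
      (\<forall>p\<in>S. \<not> p dvd Gcd (set xs))}"
  have fin: "finite (?L m S)" for m S
    by (rule finite_subset[OF _ finite_lists_length_eq[of "{..<n}" d]]) auto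
  have p: "prime p" "p dvd n" "\<not> p dvd m" using insert.prems by auto
  have cop: "coprime p m" using p by (simp add: prime_imp_coprime)
  have pm: "p * m dvd n" using cop p insert.prems(2) by (intro divides_mult)
  \<comment> \<open>The lists are split by whether \<open>p\<close> divides their gcd. Since
    \<open>p\<close> and \<open>m\<close> are coprime, those where it does are the lists of
    multiples of \<open>p * m\<close>.\<close>
  have split: "?L (p * m) S \<union> ?L m (insert p S) = ?L m S"
    and disj: "?L (p * m) S \<inter> ?L m (insert p S) = {}"
  proof -
    have "p * m dvd x \<longleftrightarrow> p dvd x \<and> m dvd x" for x
      using cop by (auto intro: divides_mult elim: dvd_mult_left dvd_mult_right)
    then show "?L (p * m) S \<union> ?L m (insert p S) = ?L m S"
      "?L (p * m) S \<inter> ?L m (insert p S) = {}"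
      by (auto simp: dvd_Gcd_iff subset_iff)
  qed
  have add: "real (card (?L (p * m) S)) + real (card (?L m (insert p S))) = real (card (?L m S))"
    using card_Un_disjoint[OF fin fin disj] split by simp
  have Lm: "real (card (?L m S)) = (real n / real m) ^ d * (\<Prod>p\<in>S. 1 - 1 / real p ^ d)"
    using insert.prems by (intro insert.IH) auto
  have Lpm: "real (card (?L (p * m) S)) =
      (real n / real (p * m)) ^ d * (\<Prod>p\<in>S. 1 - 1 / real p ^ d)"
  proof (intro insert.IH pm)
    fix q assume "q \<in> S"
    then have "prime q" "q dvd n" "\<not> q dvd m" "q \<noteq> p" using insert by auto
    then show "prime q \<and> q dvd n \<and> \<not> q dvd p * m"
      using p(1) by (auto simp: prime_dvd_mult_iff primes_dvd_imp_eq)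
  qed
  have pw: "(real n / real (p * m)) ^ d = (real n / real m) ^ d * (1 / real p ^ d)"
    by (simp add: power_divide power_mult_distrib)
  have factor: "A * Q - A * c * Q = A * Q * (1 - c)" for A Q c :: real
    by (simp add: algebra_simps)
  have "real (card (?L m (insert p S))) = real (card (?L m S)) - real (card (?L (p * m) S))"
    using add by linarith
  then have "real (card (?L m (insert p S))) =
      (real n / real m) ^ d * (\<Prod>p\<in>S. 1 - 1 / real p ^ d) * (1 - 1 / real p ^ d)"
    unfolding Lm Lpm pw by (simp only: factor)
  then show ?case using insert.hyps by (simp add: mult_ac)
qed

text \<open>The value is Jordan's totient of order \<open>d\<close>; it is the sieve with
  \<open>m = 1\<close> and all prime divisors of \<open>n\<close>.\<close>

lemma card_coprime_lists:
  assumes n: "n > 0"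
  shows "real (card {xs. length xs = d \<and> set xs \<subseteq> {..<n} \<and> coprime (Gcd (set xs)) n}) =
           real n ^ d * (\<Prod>p\<in>prime_factors n. 1 - 1 / real p ^ d)"
proof -
  have "coprime g n \<longleftrightarrow> (\<forall>p\<in>prime_factors n. \<not> p dvd g)" for g
  proof
    assume "coprime g n"
    then show "\<forall>p\<in>prime_factors n. \<not> p dvd g"
      using coprime_common_divisor in_prime_factors_iff not_prime_unit by metis
  next
    assume *: "\<forall>p\<in>prime_factors n. \<not> p dvd g"
    show "coprime g n"
    proof (rule ccontr)
      assume "\<not> coprime g n"
      then have "gcd g n \<noteq> 1" using coprime_iff_gcd_eq_1 by metis
      then obtain p where "prime p" "p dvd gcd g n" using prime_factor_nat by blast
      with * n show False by (auto simp: in_prime_factors_iff)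
    qed
  qed
  then have "{xs. length xs = d \<and> set xs \<subseteq> {..<n} \<and> coprime (Gcd (set xs)) n} =
      {xs. length xs = d \<and> set xs \<subseteq> {x. x < n \<and> 1 dvd x} \<and>
        (\<forall>p\<in>prime_factors n. \<not> p dvd Gcd (set xs))}"
    by (simp add: lessThan_def)
  moreover have "real (card {xs. length xs = d \<and> set xs \<subseteq> {x. x < n \<and> 1 dvd x} \<and>
        (\<forall>p\<in>prime_factors n. \<not> p dvd Gcd (set xs))}) =
      (real n / real 1) ^ d * (\<Prod>p\<in>prime_factors n. 1 - 1 / real p ^ d)"
    by (rule card_sieved_lists[OF n]) (auto simp: in_prime_factors_iff)
  ultimately show ?thesis by simp
qed

text \<open>Induction on the length: either the tail already has a repetition, or the head is one of
  at most \<open>d\<close> entries of the tail. The constants fit because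
  \<open>d ^ 2 + d \<le> (Suc d) ^ 2\<close>.\<close>

lemma card_not_distinct_lists_le:
  "card {xs. length xs = d \<and> set xs \<subseteq> {..<n} \<and> \<not> distinct xs} \<le> d ^ 2 * n ^ (d - 1)"
proof (induction d)
  case 0
  have "{xs :: nat list. length xs = 0 \<and> set xs \<subseteq> {..<n} \<and> \<not> distinct xs} = {}" by auto
  then show ?case by (simp only: card.empty le0)
next
  case (Suc d)
  let ?N = "{xs. length xs = d \<and> set xs \<subseteq> {..<n} \<and> \<not> distinct xs}"
  let ?L = "{xs. set xs \<subseteq> {..<n} \<and> length xs = d}"
  have finL: "finite ?L" by (simp add: finite_lists_length_eq)
  have cardL: "card ?L = n ^ d" by (simp add: card_lists_length_eq)
  have finN: "finite ?N" by (rule finite_subset[OF _ finL]) auto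
  have "{xs. length xs = Suc d \<and> set xs \<subseteq> {..<n} \<and> \<not> distinct xs}
      \<subseteq> (\<lambda>(x, xs). x # xs) ` ({..<n} \<times> ?N) \<union> (\<Union>xs\<in>?L. (\<lambda>x. x # xs) ` set xs)"
    (is "?A \<subseteq> ?B \<union> ?C")
  proof
    fix ys assume "ys \<in> ?A"
    then obtain x xs where "ys = x # xs" "length xs = d" "x < n" "set xs \<subseteq> {..<n}"
      "x \<in> set xs \<or> \<not> distinct xs"
      by (cases ys) auto
    then show "ys \<in> ?B \<union> ?C" by auto
  qed
  then have "card ?A \<le> card (?B \<union> ?C)" using finL finN by (intro card_mono) auto
  also have "\<dots> \<le> card ?B + card ?C" by (rule card_Un_le)
  also have "card ?B \<le> card ({..<n} \<times> ?N)" using finN by (intro card_image_le) auto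
  also have "\<dots> = n * card ?N" by (simp add: card_cartesian_product)
  also have "\<dots> \<le> n * (d ^ 2 * n ^ (d - 1))" by (intro mult_le_mono2 Suc.IH)
  \<comment> \<open>For \<open>d = 0\<close> the truncated exponent \<open>d - 1\<close> is
    harmless, as the factor \<open>d ^ 2\<close> vanishes.\<close>
  also have "\<dots> \<le> d ^ 2 * n ^ d" by (cases d) auto
  also have "card ?C \<le> (\<Sum>xs\<in>?L. card ((\<lambda>x. x # xs) ` set xs))" by (rule card_UN_le[OF finL])
  also have "\<dots> \<le> of_nat (card ?L) * d"
    by (rule sum_bounded_above) (use card_image_le card_length le_trans in blast)
  also have "\<dots> = d * n ^ d" by (simp add: cardL)
  finally have "card ?A \<le> d ^ 2 * n ^ d + d * n ^ d" by simp
  also have "\<dots> \<le> (Suc d) ^ 2 * n ^ (Suc d - 1)"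
    by (simp add: power2_eq_square algebra_simps)
  finally show ?case .
qed

text \<open>The \<open>fact d\<close> orderings of each generating set are exactly the distinct
  lists among those counted by Jordan's totient; the lists with repetitions form the error.\<close>

lemma card_generating_subsets_approx:
  assumes n: "n > 0"
  shows "\<bar>fact d * real (card (generating_subsets n d)) -
           real n ^ d * (\<Prod>p\<in>prime_factors n. 1 - 1 / real p ^ d)\<bar> \<le> real d ^ 2 * real n ^ (d - 1)"
proof -
  let ?S = "generating_subsets n d"
  let ?L = "{xs. length xs = d \<and> set xs \<subseteq> {..<n} \<and> coprime (Gcd (set xs)) n}"
  let ?N = "{xs. length xs = d \<and> set xs \<subseteq> {..<n} \<and> \<not> distinct xs}"
  have finL: "finite ?L"
    by (rule finite_subset[OF _ finite_lists_length_eq[of "{..<n}" d]]) auto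
  have finN: "finite ?N"
    by (rule finite_subset[OF _ finite_lists_length_eq[of "{..<n}" d]]) auto
  have eq: "{xs \<in> ?L. distinct xs} = (\<Union>J\<in>?S. permutations_of_set J)"
  proof (intro subset_antisym subsetI)
    fix xs assume "xs \<in> {xs \<in> ?L. distinct xs}"
    then have "set xs \<in> ?S" "xs \<in> permutations_of_set (set xs)"
      using n by (auto simp: generating_subsets_def generates_Zn_iff_Gcd distinct_card
          permutations_of_set_def)
    then show "xs \<in> (\<Union>J\<in>?S. permutations_of_set J)" by blast
  next
    fix xs assume "xs \<in> (\<Union>J\<in>?S. permutations_of_set J)"
    then obtain J where J: "J \<in> ?S" "set xs = J" "distinct xs"
      by (auto simp: permutations_of_set_def)
    then show "xs \<in> {xs \<in> ?L. distinct xs}"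
      using generating_subsetsD[OF J(1)] n by (auto simp: generates_Zn_iff_Gcd distinct_card[symmetric])
  qed
  have "card {xs \<in> ?L. distinct xs} = (\<Sum>J\<in>?S. card (permutations_of_set J))"
    unfolding eq using finite_generating_subsets
    by (intro card_UN_disjoint) (auto dest: permutations_of_setD(1))
  also have "\<dots> = (\<Sum>J\<in>?S. fact d)"
    using generating_subsetsD by (intro sum.cong) auto
  finally have 1: "real (card {xs \<in> ?L. distinct xs}) = fact d * real (card ?S)" by simp
  have "card {xs \<in> ?L. distinct xs} \<le> card ?L" using finL by (intro card_mono) auto
  moreover have "card ?L \<le> card ({xs \<in> ?L. distinct xs} \<union> ?N)"
    by (rule card_mono[OF finite_UnI[OF finite_subset[OF _ finL] finN]]) auto
  moreover have "card ({xs \<in> ?L. distinct xs} \<union> ?N) \<le> card {xs \<in> ?L. distinct xs} + card ?N"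
    by (rule card_Un_le)
  moreover have "card ?N \<le> d ^ 2 * n ^ (d - 1)" by (rule card_not_distinct_lists_le)
  ultimately have "\<bar>real (card {xs \<in> ?L. distinct xs}) - real (card ?L)\<bar> \<le> real (d ^ 2 * n ^ (d - 1))"
    by linarith
  then show ?thesis unfolding 1 card_coprime_lists[OF n] by simp
qed

text \<open>All factors lie in \<open>[0, 1]\<close>, so enlarging \<open>S\<close> to
  \<open>{2..N}\<close> can only shrink the product, and the full product telescopes to
  \<open>(N + 1) / (2 * N)\<close>.\<close>

lemma prod_one_minus_inverse_square_ge:
  assumes "finite S" "\<And>p. p \<in> S \<Longrightarrow> p \<ge> (2::nat)"
  shows "(\<Prod>p\<in>S. 1 - 1 / real p ^ 2) \<ge> 1 / 2"
proof -
  have tele: "(\<Prod>k=2..N. 1 - 1 / real k ^ 2) = (real N + 1) / (2 * real N)" if "N \<ge> 1" for N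
    using that
  proof (induction N rule: dec_induct)
    case (step N)
    have "(\<Prod>k=2..Suc N. 1 - 1 / real k ^ 2) = (\<Prod>k=2..N. 1 - 1 / real k ^ 2) * (1 - 1 / real (Suc N) ^ 2)"
      using step.hyps by (subst prod.nat_ivl_Suc') (auto simp: mult.commute)
    also have "\<dots> = (real (Suc N) + 1) / (2 * real (Suc N))"
      unfolding step.IH using step.hyps by (simp add: divide_simps power2_eq_square) (simp add: algebra_simps)
    finally show ?case .
  qed simp
  obtain N where N: "S \<subseteq> {2..N}" "N \<ge> 1"
  proof
    show "S \<subseteq> {2..Max (insert 1 S)}" "Max (insert 1 S) \<ge> 1" using assms by auto
  qed
  have "1 / 2 \<le> (real N + 1) / (2 * real N)" using N(2) by (simp add: field_simps)
  also have "\<dots> = (\<Prod>k=2..N. 1 - 1 / real k ^ 2)" using tele N by simp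
  also have "\<dots> \<le> (\<Prod>p\<in>S. 1 - 1 / real p ^ 2)"
  proof -
    have rng: "0 \<le> 1 - 1 / real k ^ 2 \<and> 1 - 1 / real k ^ 2 \<le> 1" if "k \<ge> 2" for k :: nat
    proof -
      have "1 \<le> real k ^ 2" using that by (intro one_le_power) simp
      then have "1 / real k ^ 2 \<le> 1 / 1" by (intro frac_le) auto
      then show ?thesis by simp
    qed
    have "(\<Prod>k=2..N. 1 - 1 / real k ^ 2) = (\<Prod>k\<in>{2..N} - S. 1 - 1 / real k ^ 2) * (\<Prod>p\<in>S. 1 - 1 / real p ^ 2)"
      using N by (intro prod.subset_diff) auto
    also have "\<dots> \<le> 1 * (\<Prod>p\<in>S. 1 - 1 / real p ^ 2)"
    proof (rule mult_right_mono)
      show "(\<Prod>k\<in>{2..N} - S. 1 - 1 / real k ^ 2) \<le> 1"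
        by (rule prod_le_1) (use rng in force)
      show "0 \<le> (\<Prod>p\<in>S. 1 - 1 / real p ^ 2)"
        by (rule prod_nonneg) (use rng assms(2) in blast)
    qed
    finally show ?thesis by simp
  qed
  finally show ?thesis .
qed

text \<open>This bound turns an absolute error into a relative one. It is where
  \<open>d \<ge> 2\<close> enters: for \<open>d = 1\<close> the product is
  \<open>totient n / n\<close>, which has no positive lower bound.\<close>

lemma prod_one_minus_inverse_power_ge:
  assumes "d \<ge> 2"
  shows "(\<Prod>p\<in>prime_factors n. 1 - 1 / real p ^ d) \<ge> 1 / 2"
proof -
  have "1 / 2 \<le> (\<Prod>p\<in>prime_factors n. 1 - 1 / real p ^ 2)"
    by (rule prod_one_minus_inverse_square_ge) (auto simp: in_prime_factors_iff prime_ge_2_nat)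
  also have "\<dots> \<le> (\<Prod>p\<in>prime_factors n. 1 - 1 / real p ^ d)"
  proof (rule prod_mono)
    fix p assume "p \<in> prime_factors n"
    then have p: "real p \<ge> 1" using prime_gt_0_nat by (auto simp: in_prime_factors_iff Suc_le_eq)
    then have "1 \<le> real p ^ 2" "real p ^ 2 \<le> real p ^ d"
      using assms by (auto intro: one_le_power power_increasing)
    then have "1 / real p ^ 2 \<le> 1 / 1" "1 / real p ^ d \<le> 1 / real p ^ 2"
      by (intro frac_le; linarith)+
    then show "0 \<le> 1 - 1 / real p ^ 2 \<and> 1 - 1 / real p ^ 2 \<le> 1 - 1 / real p ^ d"
      by simp
  qed
  finally show ?thesis .
qed

section \<open>The divisor bound\<close>

lemma card_divisors_le_prod:
  assumes n: "n > (0::nat)"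
  shows "card {g. g dvd n} \<le> (\<Prod>p\<in>prime_factors n. Suc (multiplicity p n))"
proof -
  let ?F = "\<lambda>g. restrict (\<lambda>p. multiplicity p g) (prime_factors n)"
  let ?P = "\<Pi>\<^sub>E p\<in>prime_factors n. {..multiplicity p n}"
  have "inj_on ?F {g. g dvd n}"
  proof (rule inj_onI)
    fix g h assume g: "g \<in> {g. g dvd n}" and h: "h \<in> {g. g dvd n}" and eq: "?F g = ?F h"
    show "g = h"
    proof (rule multiplicity_eq_nat)
      show "g > 0" "h > 0" using g h n by (auto intro: Nat.gr0I)
      fix p :: nat assume p: "prime p"
      show "multiplicity p g = multiplicity p h"
      proof (cases "p dvd n")
        case True
        then show ?thesis using fun_cong[OF eq, of p] p n by (simp add: in_prime_factors_iff)
      next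
        case False
        then have "\<not> p dvd g" "\<not> p dvd h" using g h by (auto dest: dvd_trans)
        then show ?thesis by (simp add: not_dvd_imp_multiplicity_0)
      qed
    qed
  qed
  moreover have "?F ` {g. g dvd n} \<subseteq> ?P"
    using n by (auto intro!: dvd_imp_multiplicity_le)
  ultimately have "card {g. g dvd n} \<le> card ?P"
    by (rule card_inj_on_le) (auto intro: finite_PiE)
  also have "\<dots> = (\<Prod>p\<in>prime_factors n. Suc (multiplicity p n))" by (simp add: card_PiE)
  finally show ?thesis .
qed

text \<open>Each prime power \<open>p ^ k\<close> contributes \<open>k + 1 \<le> p powr (\<epsilon> * k)\<close> unless
  \<open>p < 2 powr (1 / \<epsilon>)\<close>, and each of the boundedly many exceptions costs a constant factor.\<close>
lemma card_divisors_le_powr: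
  fixes \<epsilon> :: real
  assumes \<epsilon>: "\<epsilon> > 0"
  obtains C where "C \<ge> 1" "\<And>n. n > 0 \<Longrightarrow> real (card {g. g dvd n}) \<le> C * real n powr \<epsilon>"
proof -
  \<comment> \<open>Chosen so that \<open>k + 1 \<le> K * (1 + \<epsilon> * ln 2 * k)\<close>, the
    bracket being at most \<open>2 powr (\<epsilon> * k)\<close>.\<close>
  define K where "K = 1 + 1 / (\<epsilon> * ln 2)"
  \<comment> \<open>From here on \<open>p powr \<epsilon> \<ge> 2\<close>, so
    \<open>k + 1 \<le> 2 ^ k\<close> already suffices with constant 1.\<close>
  define P where "P = nat \<lceil>2 powr (1 / \<epsilon>)\<rceil>"
  have K: "K \<ge> 1" using \<epsilon> by (simp add: K_def)
  have small: "real (Suc k) \<le> K * real p powr (\<epsilon> * real k)" if "p \<ge> 2" for p k :: nat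
  proof -
    have "1 + \<epsilon> * ln 2 * real k \<le> exp (\<epsilon> * ln 2 * real k)" by (rule exp_ge_add_one_self)
    also have "\<dots> = 2 powr (\<epsilon> * real k)" by (simp add: powr_def mult_ac)
    also have "\<dots> \<le> real p powr (\<epsilon> * real k)" using that \<epsilon> by (intro powr_mono2) auto
    finally have *: "1 + \<epsilon> * ln 2 * real k \<le> real p powr (\<epsilon> * real k)" .
    have "real (Suc k) \<le> K * (1 + \<epsilon> * ln 2 * real k)"
      using \<epsilon> by (simp add: K_def field_simps)
    also have "\<dots> \<le> K * real p powr (\<epsilon> * real k)" using * K by (intro mult_left_mono) auto
    finally show ?thesis .
  qed
  have large: "real (Suc k) \<le> real p powr (\<epsilon> * real k)" if "p \<ge> P" for p k :: nat
  proof -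
    have "Suc k \<le> 2 ^ k" by (induction k) auto
    then have "real (Suc k) \<le> 2 ^ k" by (metis of_nat_le_iff of_nat_numeral of_nat_power)
    also have "\<dots> = (2 powr (1 / \<epsilon>)) powr (\<epsilon> * real k)"
      using \<epsilon> by (simp add: powr_powr powr_realpow)
    also have "\<dots> \<le> real p powr (\<epsilon> * real k)"
    proof (rule powr_mono2)
      show "2 powr (1 / \<epsilon>) \<le> real p" using that unfolding P_def by linarith
    qed (use \<epsilon> in auto)
    finally show ?thesis .
  qed
  have "real (card {g. g dvd n}) \<le> K ^ P * real n powr \<epsilon>" if n: "n > 0" for n :: nat
  proof -
    let ?f = "\<lambda>p. (real p powr (\<epsilon> * real (multiplicity p n)))"
    let ?c = "\<lambda>p. if p < P then K else 1"
    have "real (card {g. g dvd n}) \<le> (\<Prod>p\<in>prime_factors n. real (Suc (multiplicity p n)))"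
      using card_divisors_le_prod[OF n] by (metis of_nat_le_iff of_nat_prod)
    also have "\<dots> \<le> (\<Prod>p\<in>prime_factors n. ?c p * ?f p)"
      using small large by (intro prod_mono) (auto simp: in_prime_factors_iff prime_ge_2_nat)
    also have "\<dots> = (\<Prod>p\<in>prime_factors n. ?c p) * (\<Prod>p\<in>prime_factors n. ?f p)"
      by (rule prod.distrib)
    also have "(\<Prod>p\<in>prime_factors n. ?f p) = real n powr \<epsilon>"
    proof -
      have "(\<Prod>p\<in>prime_factors n. ?f p) = (\<Prod>p\<in>prime_factors n. (real p ^ multiplicity p n) powr \<epsilon>)"
        by (intro prod.cong refl)
          (auto simp: powr_powr mult.commute in_prime_factors_iff prime_gt_0_nat simp flip: powr_realpow)
      also have "\<dots> = (\<Prod>p\<in>prime_factors n. real p ^ multiplicity p n) powr \<epsilon>"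
        by (rule prod_powr_distrib[symmetric])
      also have "(\<Prod>p\<in>prime_factors n. real p ^ multiplicity p n) = real n"
        using prime_factorization_nat[OF n] by (metis (no_types, lifting) of_nat_power of_nat_prod prod.cong)
      finally show ?thesis .
    qed
    also have "(\<Prod>p\<in>prime_factors n. ?c p) \<le> K ^ P"
    proof -
      have "(\<Prod>p\<in>prime_factors n. ?c p) = (\<Prod>p\<in>prime_factors n \<inter> {..<P}. K)"
        by (simp add: prod.If_cases lessThan_def)
      also have "\<dots> = K ^ card (prime_factors n \<inter> {..<P})" by simp
      also have "\<dots> \<le> K ^ card {..<P}" using K by (intro power_increasing card_mono) auto
      finally show ?thesis by simp
    qed
    finally show ?thesis by (simp add: mult_right_mono)
  qed
  moreover have "K ^ P \<ge> 1" using K by (rule one_le_power)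
  ultimately show thesis using that by blast
qed

subsection \<open>Counting equivalence classes\<close>

text \<open>Units commute and act injectively, so a unit stabilising the image of \<open>J\<close>
  stabilises \<open>J\<close>.\<close>

lemma good_set_unit_image:
  assumes "good_set n J" "coprime a n" "J \<subseteq> {..<n}" "n > 0"
  shows "good_set n (unit_image n a J)"
  unfolding good_set_def
proof (intro conjI ballI impI)
  show "sidon_mod n (unit_image n a J)"
    using assms sidon_mod_unit_image by (simp add: good_set_def)
  fix b assume b: "b \<in> totatives n" and eq: "unit_image n b (unit_image n a J) = unit_image n a J"
  have "(\<lambda>x. a * x mod n) ` unit_image n b J = unit_image n a (unit_image n b J)"
    by (simp only: unit_image_def)
  also have "\<dots> = unit_image n a J"
    using eq by (simp only: unit_image_comp mult.commute)
  finally have "(\<lambda>x. a * x mod n) ` unit_image n b J = (\<lambda>x. a * x mod n) ` J"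
    by (simp only: unit_image_def)
  then have "unit_image n b J = J"
    by (simp only: inj_on_image_eq_iff[OF inj_on_mult_mod[OF assms(2) order.refl]
          unit_image_subset[OF assms(4)] assms(3)])
  then show "b = 1" using assms(1) b by (simp add: good_set_def)
qed

text \<open>If \<open>a\<close> and \<open>b\<close> have the same effect on \<open>J\<close>, then
  \<open>a\<close> times an inverse of \<open>b\<close> stabilises \<open>J\<close>. The
  representative \<open>u\<close> of this product in \<open>totatives n\<close> is therefore
  1.\<close>

lemma inj_on_good_orbit:
  assumes "good_set n J" "J \<subseteq> {..<n}" "n > 0"
  shows "inj_on (\<lambda>a. unit_image n a J) (totatives n)"
proof (rule inj_onI)
  fix a b assume a: "a \<in> totatives n" and b: "b \<in> totatives n"
    and eq: "unit_image n a J = unit_image n b J"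
  obtain c where c: "coprime c n" "[c * b = 1] (mod n)"
    using coprime_inverse_mod[of b n] b by (auto simp: in_totatives_iff)
  have "coprime (c * a) n" using a c by (simp add: in_totatives_iff)
  then obtain u where u: "u \<in> totatives n" "[u = c * a] (mod n)"
    using coprime_cong_totatives assms(3) by blast
  have "unit_image n u J = unit_image n c (unit_image n a J)"
    using unit_image_cong[OF u(2)] by (simp only: unit_image_comp)
  also have "\<dots> = unit_image n 1 J"
    unfolding eq unit_image_comp by (rule unit_image_cong[OF c(2)])
  also have "\<dots> = J" by (rule unit_image_one[OF assms(2)])
  finally have "u = 1" using assms(1) u(1) by (simp add: good_set_def)
  then have "[c * a = c * b] (mod n)"
    using u(2) c(2) by (metis cong_sym cong_trans)
  then have "[a = b] (mod n)" using c(1) by (simp only: cong_mult_lcancel_nat)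
  then show "a = b" using a b totatives_cong_eq by blast
qed

lemma frame_equiv_class_good:
  assumes J: "J \<in> generating_subsets n d" "good_set n J" and n: "n > 0"
  shows "{K \<in> {J \<in> generating_subsets n d. good_set n J}.
            frame_equiv_rel n d `` {K} = frame_equiv_rel n d `` {J}} =
         (\<lambda>a. unit_image n a J) ` totatives n"
proof (intro subset_antisym subsetI)
  fix K assume "K \<in> {K \<in> {J \<in> generating_subsets n d. good_set n J}.
    frame_equiv_rel n d `` {K} = frame_equiv_rel n d `` {J}}"
  then have K: "K \<in> generating_subsets n d"
    and eq: "frame_equiv_rel n d `` {K} = frame_equiv_rel n d `` {J}" by auto
  \<comment> \<open>Reflexivity puts \<open>K\<close> into its own class, so equality of the classes
    relates \<open>J\<close> to \<open>K\<close>.\<close>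
  have "(K, K) \<in> frame_equiv_rel n d"
    using K frame_equivalent_refl by (simp add: frame_equiv_rel_def)
  then have "(J, K) \<in> frame_equiv_rel n d" using eq by blast
  then obtain a where a: "a \<in> totatives n" "J = unit_image n a K"
    using frame_equivalent_sidon[OF J(1) K n] J(2)
    by (auto simp: frame_equiv_rel_def good_set_def)
  then have "coprime a n" by (simp add: in_totatives_iff)
  then obtain b where b: "coprime b n" "unit_image n b J = K"
    using unit_image_inverse[OF _ generating_subsetsD(1)[OF K]] a(2) by metis
  obtain b' where "b' \<in> totatives n" "[b' = b] (mod n)"
    using coprime_cong_totatives[OF b(1) n] .
  then show "K \<in> (\<lambda>a. unit_image n a J) ` totatives n"
    using b(2) unit_image_cong by blast
next
  fix K assume "K \<in> (\<lambda>a. unit_image n a J) ` totatives n"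
  then obtain a where "coprime a n" "K = unit_image n a J" by (auto simp: in_totatives_iff)
  then show "K \<in> {K \<in> {J \<in> generating_subsets n d. good_set n J}.
      frame_equiv_rel n d `` {K} = frame_equiv_rel n d `` {J}}"
    using J n unit_image_generating good_set_unit_image generating_subsetsD(1)[OF J(1)]
      frame_equiv_class_unit_image by simp
qed

lemma card_eq_sum_fibres:
  "finite A \<Longrightarrow> card A = (\<Sum>c\<in>f ` A. card {x \<in> A. f x = c})"
  using sum.image_gen[of A "\<lambda>_. 1 :: nat" f] by simp

lemma card_good_classes:
  fixes n d :: nat
  defines "G \<equiv> {J \<in> generating_subsets n d. good_set n J}"
  assumes n: "n > 0"
  shows "card ((\<lambda>J. frame_equiv_rel n d `` {J}) ` G) * totient n = card G"
proof -
  let ?f = "\<lambda>J. frame_equiv_rel n d `` {J}"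
  have fin: "finite G" unfolding G_def using finite_generating_subsets by simp
  have fibre: "card {K \<in> G. ?f K = c} = totient n" if c: "c \<in> ?f ` G" for c
  proof -
    obtain J where J: "J \<in> generating_subsets n d" "good_set n J" "c = ?f J"
      using c unfolding G_def by blast
    have "card {K \<in> G. ?f K = c} = card ((\<lambda>a. unit_image n a J) ` totatives n)"
      unfolding G_def J(3) frame_equiv_class_good[OF J(1,2) n] ..
    also have "\<dots> = card (totatives n)"
      by (rule card_image[OF inj_on_good_orbit[OF J(2) generating_subsetsD(1)[OF J(1)] n]])
    finally show ?thesis by (simp add: totient_def)
  qed
  have "card G = (\<Sum>c\<in>?f ` G. card {K \<in> G. ?f K = c})" by (rule card_eq_sum_fibres[OF fin])
  also have "\<dots> = (\<Sum>c\<in>?f ` G. totient n)" by (rule sum.cong[OF refl fibre])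
  finally show ?thesis by simp
qed

text \<open>The \<open>totient n\<close> multipliers are distributed over the orbit, at most
  \<open>d ^ d\<close> of them to each member.\<close>

lemma totient_le_card_orbit:
  assumes "J \<in> generating_subsets n d" "n > 0"
  shows "totient n \<le> d ^ d * card ((\<lambda>a. unit_image n a J) ` totatives n)"
proof -
  let ?O = "(\<lambda>a. unit_image n a J) ` totatives n"
  have "totatives n = (\<Union>K\<in>?O. {a \<in> totatives n. unit_image n a J = K})" by blast
  then have "totient n = card (\<Union>K\<in>?O. {a \<in> totatives n. unit_image n a J = K})"
    by (simp only: totient_def)
  also have "\<dots> \<le> card ?O * d ^ d"
    by (rule card_UN_bounded) (use card_unit_fibre_le[OF assms] in auto)
  finally show ?thesis by (simp only: mult.commute)
qed

text \<open>The bad members of each class contain a whole unit orbit, since badness is invariant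
  under units. Only an inequality is claimed, because several orbits may fall into one
  class.\<close>

lemma card_bad_classes:
  fixes n d :: nat
  defines "B \<equiv> {J \<in> generating_subsets n d. \<not> good_set n J}"
  assumes n: "n > 0"
  shows "card ((\<lambda>J. frame_equiv_rel n d `` {J}) ` B) * totient n \<le> d ^ d * card B"
proof -
  let ?f = "\<lambda>J. frame_equiv_rel n d `` {J}"
  have fin: "finite B" unfolding B_def using finite_generating_subsets by simp
  have fibre: "totient n \<le> d ^ d * card {K \<in> B. ?f K = c}" if c: "c \<in> ?f ` B" for c
  proof -
    obtain J where J: "J \<in> generating_subsets n d" "\<not> good_set n J" "c = ?f J"
      using c unfolding B_def by blast
    have "(\<lambda>a. unit_image n a J) ` totatives n \<subseteq> {K \<in> B. ?f K = c}"
    proof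
      fix K assume "K \<in> (\<lambda>a. unit_image n a J) ` totatives n"
      then obtain a where a: "coprime a n" "K = unit_image n a J" by (auto simp: in_totatives_iff)
      have K: "K \<in> generating_subsets n d" using unit_image_generating J(1) a n by simp
      obtain b where b: "coprime b n" "unit_image n b K = J"
        using unit_image_inverse[OF a(1) generating_subsetsD(1)[OF J(1)]] a(2) by metis
      have "\<not> good_set n K"
        using good_set_unit_image[OF _ b(1) generating_subsetsD(1)[OF K] n] b(2) J(2) by metis
      then show "K \<in> {K \<in> B. ?f K = c}"
        using K frame_equiv_class_unit_image[OF J(1) a(1) n] J(3) a(2) by (simp add: B_def)
    qed
    then have "card ((\<lambda>a. unit_image n a J) ` totatives n) \<le> card {K \<in> B. ?f K = c}"
      using fin by (intro card_mono) auto
    then show ?thesis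
      using totient_le_card_orbit[OF J(1) n] mult_le_mono2 le_trans by blast
  qed
  have "card (?f ` B) * totient n = (\<Sum>c\<in>?f ` B. totient n)" by simp
  also have "\<dots> \<le> (\<Sum>c\<in>?f ` B. d ^ d * card {K \<in> B. ?f K = c})" by (rule sum_mono[OF fibre])
  also have "\<dots> = d ^ d * card B"
    unfolding card_eq_sum_fibres[OF fin, of ?f] by (simp only: sum_distrib_left)
  finally show ?thesis .
qed

text \<open>The good classes alone give the lower bound; adding the bad classes gives the upper
  bound. Both differ from the number of generating sets only by multiples of the number of bad
  sets.\<close>

lemma h_count_approx:
  assumes n: "n > 0" and d: "d \<ge> 1"
  shows "\<bar>real (h_count n d) * real (totient n) - real (card (generating_subsets n d))\<bar> \<le>
    real d ^ d * real (card {J \<in> generating_subsets n d. \<not> good_set n J})"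
proof -
  let ?S = "generating_subsets n d"
  let ?G = "{J \<in> ?S. good_set n J}" and ?B = "{J \<in> ?S. \<not> good_set n J}"
  let ?f = "\<lambda>J. frame_equiv_rel n d `` {J}"
  have fin: "finite ?S" by (rule finite_generating_subsets)
  have S: "?S = ?G \<union> ?B" by blast
  have "?S // frame_equiv_rel n d = ?f ` ?S" by (auto simp: quotient_def)
  then have h: "h_count n d = card (?f ` ?S)" by (simp add: h_count_def)
  have cardS: "card ?S = card ?G + card ?B"
    using fin by (subst S, intro card_Un_disjoint) auto
  have "card (?f ` ?G) \<le> h_count n d"
    unfolding h using fin by (intro card_mono) auto
  then have lower: "card ?G \<le> h_count n d * totient n"
    unfolding card_good_classes[OF n, of d, symmetric] by (rule mult_le_mono1)
  have image_S: "?f ` ?S = ?f ` ?G \<union> ?f ` ?B" by blast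
  have "h_count n d \<le> card (?f ` ?G) + card (?f ` ?B)"
    unfolding h image_S by (rule card_Un_le)
  then have "h_count n d * totient n \<le> (card (?f ` ?G) + card (?f ` ?B)) * totient n"
    by (rule mult_le_mono1)
  also have "\<dots> \<le> card ?G + d ^ d * card ?B"
    unfolding distrib_right using card_good_classes[OF n, of d] card_bad_classes[OF n, of d] by linarith
  finally have upper: "h_count n d * totient n \<le> card ?G + d ^ d * card ?B" .
  have "1 * card ?B \<le> d ^ d * card ?B" using d by (intro mult_le_mono1) simp
  then have "card ?S \<le> h_count n d * totient n + d ^ d * card ?B"
    "h_count n d * totient n \<le> card ?S + d ^ d * card ?B"
    using lower upper cardS by linarith+
  then have "real (card ?S) \<le> real (h_count n d * totient n + d ^ d * card ?B)"
    "real (h_count n d * totient n) \<le> real (card ?S + d ^ d * card ?B)"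
    by (simp_all only: of_nat_le_iff)
  then show ?thesis by (simp add: abs_le_iff)
qed

section \<open>Comparison with the main term\<close>

lemma main_term_scaled:
  assumes "n > 0"
  shows "main_term n d * (fact d * real (totient n)) =
           real n ^ d * (\<Prod>p\<in>prime_factors n. 1 - 1 / real p ^ d)"
proof -
  have "(\<Prod>p\<in>prime_factors n. 1 - real p powr (- real d)) =
      (\<Prod>p\<in>prime_factors n. 1 - 1 / real p ^ d)"
    by (intro prod.cong refl)
      (auto simp: in_prime_factors_iff powr_minus powr_realpow prime_gt_0_nat inverse_eq_divide)
  moreover have "fact d * real (totient n) \<noteq> 0" using assms by simp
  ultimately show ?thesis by (simp add: main_term_def)
qed

lemma h_count_main_term_bound:
  assumes d: "d \<ge> 2" and \<epsilon>: "\<epsilon> > 0"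
  obtains C where "\<And>n. n > 0 \<Longrightarrow>
    \<bar>real (h_count n d) - main_term n d\<bar> \<le> C * main_term n d * real n powr (\<epsilon> - 1)"
proof -
  obtain C0 where C0: "C0 \<ge> 1"
    "\<And>n. n > 0 \<Longrightarrow> real (card {g. g dvd n}) \<le> C0 * real n powr \<epsilon>"
    using card_divisors_le_powr[OF \<epsilon>] by blast
  \<comment> \<open>The factor from \<open>card_not_good_le\<close> with the divisor count replaced
    by \<open>C0 * n powr \<epsilon>\<close>; the remaining terms absorb
    \<open>n powr \<epsilon> \<ge> 1\<close>.\<close>
  define M where "M = real d ^ 3 + 2 * real d + real d ^ 2 + 2 * real d * C0"
  \<comment> \<open>After scaling by \<open>fact d * totient n\<close>, the first summand pays for
    the bad sets and the second for lists with repetitions.\<close>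
  define C1 where "C1 = fact d * real d ^ d * M + real d ^ 2"
  have "\<bar>real (h_count n d) - main_term n d\<bar> \<le> (2 * C1) * main_term n d * real n powr (\<epsilon> - 1)"
    if n: "n > 0" for n
  proof -
    let ?N = "real (card (generating_subsets n d))"
    let ?B = "real (card {J \<in> generating_subsets n d. \<not> good_set n J})"
    let ?X = "real n powr \<epsilon> * real n ^ (d - 1)"
    let ?w = "fact d * real (totient n)"
    let ?P = "\<Prod>p\<in>prime_factors n. 1 - 1 / real p ^ d"
    have w: "?w > 0" using n by simp
    have X1: "real n powr \<epsilon> \<ge> 1" using n \<epsilon> by (intro ge_one_powr_ge_zero) auto
    have B: "?B \<le> M * ?X"
    proof -
      have "?B \<le> real ((d ^ 3 + 2 * d + d ^ 2 + d * (card {g. g dvd n} * 2)) * n ^ (d - 1))"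
        using card_not_good_le[OF n, of d] d by (simp only: of_nat_le_iff)
      also have "\<dots> = (real d ^ 3 + 2 * real d + real d ^ 2 + 2 * real d * real (card {g. g dvd n}))
          * real n ^ (d - 1)"
        by simp
      also have "\<dots> \<le> (M * real n powr \<epsilon>) * real n ^ (d - 1)"
      proof (rule mult_right_mono)
        have "(real d ^ 3 + 2 * real d + real d ^ 2) * 1 \<le>
            (real d ^ 3 + 2 * real d + real d ^ 2) * real n powr \<epsilon>"
          using X1 by (intro mult_left_mono) auto
        moreover have "2 * real d * real (card {g. g dvd n}) \<le> 2 * real d * (C0 * real n powr \<epsilon>)"
          using C0(2)[OF n] by (intro mult_left_mono) auto
        ultimately show "real d ^ 3 + 2 * real d + real d ^ 2 + 2 * real d * real (card {g. g dvd n})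
            \<le> M * real n powr \<epsilon>"
          unfolding M_def distrib_right by linarith
      qed simp
      finally show ?thesis by (simp only: mult.assoc)
    qed
    have "\<bar>real (h_count n d) - main_term n d\<bar> * ?w =
        \<bar>fact d * (real (h_count n d) * real (totient n)) - main_term n d * ?w\<bar>"
    proof -
      have "\<bar>real (h_count n d) - main_term n d\<bar> * ?w = \<bar>(real (h_count n d) - main_term n d) * ?w\<bar>"
        by (rule abs_mult_pos[OF less_imp_le[OF w]])
      then show ?thesis by (simp add: algebra_simps)
    qed
    also have "\<dots> \<le> fact d * \<bar>real (h_count n d) * real (totient n) - ?N\<bar> +
        \<bar>fact d * ?N - real n ^ d * ?P\<bar>"
    proof -
      have "fact d * \<bar>real (h_count n d) * real (totient n) - ?N\<bar> =
          \<bar>fact d * (real (h_count n d) * real (totient n)) - fact d * ?N\<bar>"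
        unfolding right_diff_distrib[symmetric] abs_mult by simp
      then show ?thesis unfolding main_term_scaled[OF n] by linarith
    qed
    also have "\<dots> \<le> fact d * (real d ^ d * (M * ?X)) + real d ^ 2 * ?X"
    proof (rule add_mono)
      have "\<bar>real (h_count n d) * real (totient n) - ?N\<bar> \<le> real d ^ d * ?B"
        using d by (intro h_count_approx n) simp
      also have "\<dots> \<le> real d ^ d * (M * ?X)" using B by (intro mult_left_mono) auto
      finally show "fact d * \<bar>real (h_count n d) * real (totient n) - ?N\<bar> \<le>
          fact d * (real d ^ d * (M * ?X))"
        by (intro mult_left_mono) auto
      have "\<bar>fact d * ?N - real n ^ d * ?P\<bar> \<le> real d ^ 2 * real n ^ (d - 1)"
        by (rule card_generating_subsets_approx[OF n])
      also have "\<dots> \<le> real d ^ 2 * ?X"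
        using mult_right_mono[OF X1, of "real n ^ (d - 1)"] by (intro mult_left_mono) auto
      finally show "\<bar>fact d * ?N - real n ^ d * ?P\<bar> \<le> real d ^ 2 * ?X" .
    qed
    also have "\<dots> = C1 * ?X" by (simp add: C1_def algebra_simps)
    \<comment> \<open>The factor 2 compensates for \<open>?P \<ge> 1 / 2\<close>, so that the scaled
      main term can appear on the right.\<close>
    also have "\<dots> \<le> C1 * (2 * (real n ^ d * ?P * real n powr (\<epsilon> - 1)))"
    proof (rule mult_left_mono)
      have "real n powr (\<epsilon> - 1) = real n powr \<epsilon> / real n" using n by (simp add: powr_diff)
      moreover have "real n ^ d = real n ^ (d - 1) * real n"
        using d by (metis One_nat_def Suc_1 Suc_le_lessD Suc_lessD power_minus_mult)
      ultimately have "2 * (real n ^ d * ?P * real n powr (\<epsilon> - 1)) = ?X * (2 * ?P)"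
        using n by simp
      moreover have "?X * 1 \<le> ?X * (2 * ?P)"
        using prod_one_minus_inverse_power_ge[OF d, of n] by (intro mult_left_mono) auto
      ultimately show "?X \<le> 2 * (real n ^ d * ?P * real n powr (\<epsilon> - 1))"
        by (simp only: mult_1_right)
      show "0 \<le> C1" using C0(1) by (simp add: C1_def M_def)
    qed
    also have "\<dots> = ((2 * C1) * main_term n d * real n powr (\<epsilon> - 1)) * ?w"
      unfolding main_term_scaled[OF n, symmetric] by (simp only: mult_ac)
    finally show ?thesis by (rule mult_right_le_imp_le[OF _ w])
  qed
  then show thesis by (rule that)
qed

theorem theorem3p1:
  shows "(\<forall>n::nat. n \<ge> 1 \<longrightarrow> h_count n 1 = 1) \<and>
    (\<forall>d::nat. d \<ge> 2 \<longrightarrow> (\<forall>\<epsilon>::real. \<epsilon> > 0 \<longrightarrow>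
      (\<exists>C::real. \<forall>\<^sub>F n in at_top.
         \<bar>real (h_count n d) - main_term n d\<bar> \<le> C * main_term n d * real n powr (\<epsilon> - 1))))"
proof (intro conjI allI impI)
  fix n :: nat assume "n \<ge> 1"
  then show "h_count n 1 = 1" by (rule h_count_one)
next
  fix d :: nat and \<epsilon> :: real
  assume "d \<ge> 2" "\<epsilon> > 0"
  then obtain C where "\<And>n. n > 0 \<Longrightarrow>
      \<bar>real (h_count n d) - main_term n d\<bar> \<le> C * main_term n d * real n powr (\<epsilon> - 1)"
    using h_count_main_term_bound[of d \<epsilon>] by metis
  then show "\<exists>C. \<forall>\<^sub>F n in at_top.
      \<bar>real (h_count n d) - main_term n d\<bar> \<le> C * main_term n d * real n powr (\<epsilon> - 1)"
    by (intro exI[of _ C] eventually_mono[OF eventually_gt_at_top[of "0 :: nat"]])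
qed

end
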